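(* Let $\alpha>0$, let $-\infty<A_1<A_2<+\infty$, let $V:[A_1,A_2]\to\mathbb{R}$ be a smooth function with $V'(A_1)=V'(A_2)=0$, and set $U=V-\alpha^2V''$. Let $\mathbf{u}^0(x,y)=(U(y),0)$, $\mathbf{v}^0(x,y)=(V(y),0)$, $\pi(x,y)=p_0-\frac12V(y)^2+\frac{\alpha^2}{2}(V'(y))^2$ (with $p_0\in\mathbb{R}$ constant) be the corresponding steady state solution of the $\alpha$-Euler equations on $D=\mathbb{R}\times[A_1,A_2]$. Suppose that the linearized stream function equation about this steady state, $$\Delta\widetilde{\psi}_t+V(y)\,\Delta\widetilde{\psi}_x-U''(y)\,\widetilde{\phi}_x=0\ \text{ on } D,\qquad \widetilde{\psi}=(1-\alpha^2\Delta)\widetilde{\phi},$$ with boundary conditions $\nabla\widetilde{\phi}\cdot\mathbf{t}=0$ and $\big((\mathbf{n}\cdot\nabla)(-\nabla^{\perp}\widetilde{\phi})\big)\cdot\mathbf{t}=0$ on $\partial D$, has a nontrivial solution of the form $$\widetilde{\psi}(x,y,t)=\psi(y)e^{ik(x-ct)},\qquad \widetilde{\phi}(x,y,t)=\phi(y)e^{ik(x-ct)},$$ where $k\in\mathbb{R}\setminus\{0\}$, $c=c_r+ic_i\in\mathbb{C}$ with $c_i>0$, and $\phi,\psi:[A_1,A_2]\to\mathbb{C}$ with $\phi\in H^4([A_1,A_2];\mathbb{C})$, $\phi\not\equiv0$. Let $y_s\in[A_1,A_2]$ be a point such that $U''(y_s)=0$ (such a point exists under these hypotheses). Then $U''(y)\,(V(y)-V(y_s))<0$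 for at least one point $y\in[A_1,A_2]$.
   Context: The $\alpha$-Euler equations are $\mathbf{u}_t+(\mathbf{v}\cdot\nabla)\mathbf{u}+(\nabla\mathbf{v})^{\top}\mathbf{u}+\nabla\pi=0$, $(1-\alpha^2\Delta)\mathbf{v}=\mathbf{u}$, $\operatorname{div}\mathbf{u}=\operatorname{div}\mathbf{v}=0$, where $\nabla\mathbf{v}$ is the Jacobi matrix $(\partial v_i/\partial x_j)$, with boundary conditions $\mathbf{v}\cdot\mathbf{n}=0$ and $(\mathbf{n}\cdot\nabla)\mathbf{v}$ parallel to $\mathbf{n}$ on $\partial D$. Notation: $\nabla^{\perp}=(-\partial_y,\partial_x)$; $\mathbf{n}$ is the unit outer normal and $\mathbf{t}=(1,0)$ the unit tangent on the walls $y=A_1$, $y=A_2$. The stream functions $\phi,\psi$ of $\mathbf{v},\mathbf{u}$ satisfy $\mathbf{v}=-\nabla^{\perp}\phi$, $\mathbf{u}=-\nabla^{\perp}\psi$, $\psi=(1-\alpha^2\Delta)\phi$; for the shear steady state $\partial_y\phi^0=V$, $\partial_y\psi^0=U$. The displayed linear equation is the linearization of the stream-function (vorticity) form of the equations about this steady state. *)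

theory Defs
  imports "HOL-Analysis.Analysis"
begin

section \<open>Functions on a compact interval\<close>

text \<open>Derivatives are taken within \<open>{a..b}\<close>, so they are one-sided at \<open>a\<close> and \<open>b\<close>.\<close>

definition ivl_deriv :: "real \<Rightarrow> real \<Rightarrow> nat \<Rightarrow> (real \<Rightarrow> 'a::real_normed_vector) \<Rightarrow> real \<Rightarrow> 'a" where
  "ivl_deriv a b n f = ((\<lambda>g y. vector_derivative g (at y within {a..b})) ^^ n) f"

definition smooth_on_ivl :: "real \<Rightarrow> real \<Rightarrow> (real \<Rightarrow> 'a::real_normed_vector) \<Rightarrow> bool" where
  "smooth_on_ivl a b f \<longleftrightarrow>
     (\<forall>n. \<forall>y\<in>{a..b}. ivl_deriv a b n f differentiable (at y within {a..b}))"


section \<open>Weak derivatives and Sobolev spaces on an interval\<close>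

definition test_function :: "real \<Rightarrow> real \<Rightarrow> (real \<Rightarrow> real) \<Rightarrow> bool" where
  "test_function a b \<eta> \<longleftrightarrow>
     (\<forall>n x. (deriv ^^ n) \<eta> differentiable (at x)) \<and>
     compact (closure {x. \<eta> x \<noteq> 0}) \<and> closure {x. \<eta> x \<noteq> 0} \<subseteq> {a<..<b}"

definition locally_integrable :: "real \<Rightarrow> real \<Rightarrow> (real \<Rightarrow> complex) \<Rightarrow> bool" where
  "locally_integrable a b f \<longleftrightarrow>
     (\<forall>r s. a < r \<longrightarrow> s < b \<longrightarrow> integrable (lebesgue_on {r..s}) f)"

text \<open>\<open>g\<close> is a weak derivative of order \<open>n\<close> of \<open>f\<close> on the open interval \<open>(a,b)\<close>.\<close>

definition is_weak_deriv ::
    "real \<Rightarrow> real \<Rightarrow> nat \<Rightarrow> (real \<Rightarrow> complex) \<Rightarrow> (real \<Rightarrow> complex) \<Rightarrow> bool" where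
  "is_weak_deriv a b n f g \<longleftrightarrow>
     locally_integrable a b f \<and> locally_integrable a b g \<and>
     (\<forall>\<eta>. test_function a b \<eta> \<longrightarrow>
        integral\<^sup>L (lebesgue_on {a<..<b}) (\<lambda>y. (deriv ^^ n) \<eta> y *\<^sub>R f y) =
        (-1) ^ n * integral\<^sup>L (lebesgue_on {a<..<b}) (\<lambda>y. \<eta> y *\<^sub>R g y))"

text \<open>If it exists, the weak derivative is unique up to a null set; this picks a representative,
  so that it should only occur in statements that hold almost everywhere.\<close>

definition weak_deriv :: "real \<Rightarrow> real \<Rightarrow> nat \<Rightarrow> (real \<Rightarrow> complex) \<Rightarrow> real \<Rightarrow> complex" where
  "weak_deriv a b n f = (SOME g. is_weak_deriv a b n f g)"

definition square_integrable :: "real \<Rightarrow> real \<Rightarrow> (real \<Rightarrow> complex) \<Rightarrow> bool" where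
  "square_integrable a b f \<longleftrightarrow>
     f \<in> borel_measurable (lebesgue_on {a<..<b}) \<and>
     integrable (lebesgue_on {a<..<b}) (\<lambda>y. (norm (f y))\<^sup>2)"

definition sobolev_H :: "nat \<Rightarrow> real \<Rightarrow> real \<Rightarrow> (real \<Rightarrow> complex) set" where
  "sobolev_H m a b =
     {f. square_integrable a b f \<and> (\<forall>j\<le>m. \<exists>g. square_integrable a b g \<and> is_weak_deriv a b j f g)}"


section \<open>Fields on the strip\<close>

text \<open>Fields are functions of \<open>x\<close>, \<open>y\<close>, \<open>t\<close>. The strip is \<open>A\<^sub>1 \<le> y \<le> A\<^sub>2\<close>, and \<open>dy\<close> is one-sided on
  its boundary. The operators are polymorphic in the codomain and are used for real, complex and
  vector-valued fields alike.\<close>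

type_synonym 'a field = "real \<Rightarrow> real \<Rightarrow> real \<Rightarrow> 'a"

definition dx :: "'a::real_normed_vector field \<Rightarrow> 'a field" where
  "dx F = (\<lambda>x y t. vector_derivative (\<lambda>s. F s y t) (at x))"

definition dy :: "real \<Rightarrow> real \<Rightarrow> 'a::real_normed_vector field \<Rightarrow> 'a field" where
  "dy A1 A2 F = (\<lambda>x y t. vector_derivative (\<lambda>s. F x s t) (at y within {A1..A2}))"

definition dt :: "'a::real_normed_vector field \<Rightarrow> 'a field" where
  "dt F = (\<lambda>x y t. vector_derivative (\<lambda>s. F x y s) (at t))"

definition grad :: "real \<Rightarrow> real \<Rightarrow> 'a::real_normed_vector field \<Rightarrow> ('a \<times> 'a) field" where
  "grad A1 A2 F = (\<lambda>x y t. (dx F x y t, dy A1 A2 F x y t))"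

definition perp_grad :: "real \<Rightarrow> real \<Rightarrow> 'a::real_normed_vector field \<Rightarrow> ('a \<times> 'a) field" where
  "perp_grad A1 A2 F = (\<lambda>x y t. (- dy A1 A2 F x y t, dx F x y t))"

definition laplace :: "real \<Rightarrow> real \<Rightarrow> 'a::real_normed_vector field \<Rightarrow> 'a field" where
  "laplace A1 A2 F = (\<lambda>x y t. dx (dx F) x y t + dy A1 A2 (dy A1 A2 F) x y t)"

definition dir_deriv ::
    "real \<Rightarrow> real \<Rightarrow> real \<times> real \<Rightarrow> 'a::real_normed_vector field \<Rightarrow> 'a field" where
  "dir_deriv A1 A2 n F = (\<lambda>x y t. fst n *\<^sub>R dx F x y t + snd n *\<^sub>R dy A1 A2 F x y t)"

definition dot2 :: "'a::real_vector \<times> 'a \<Rightarrow> real \<times> real \<Rightarrow> 'a" where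
  "dot2 w e = fst e *\<^sub>R fst w + snd e *\<^sub>R snd w"

text \<open>The two walls, each given by its height and its unit outer normal.\<close>

definition walls :: "real \<Rightarrow> real \<Rightarrow> (real \<times> (real \<times> real)) set" where
  "walls A1 A2 = {(A1, (0, -1)), (A2, (0, 1))}"

definition tangent :: "real \<times> real" where
  "tangent = (1, 0)"


section \<open>The \<open>\<alpha>\<close>-Euler equations\<close>

text \<open>With \<open>\<nabla>v = (\<partial>v\<^sub>i/\<partial>x\<^sub>j)\<close>, the components of \<open>(\<nabla>v)\<^sup>T u\<close> are the inner products of \<open>u\<close> with
  \<open>\<partial>v/\<partial>x\<close> and with \<open>\<partial>v/\<partial>y\<close>.\<close>

definition alpha_euler ::
    "real \<Rightarrow> real \<Rightarrow> real \<Rightarrow> (real \<times> real) field \<Rightarrow> (real \<times> real) field \<Rightarrow> real field \<Rightarrow> bool" where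
  "alpha_euler \<alpha> A1 A2 u v p \<longleftrightarrow>
     (\<forall>x t. \<forall>y\<in>{A1..A2}.
        dt u x y t + dir_deriv A1 A2 (v x y t) u x y t
          + (u x y t \<bullet> dx v x y t, u x y t \<bullet> dy A1 A2 v x y t) + grad A1 A2 p x y t = 0 \<and>
        v x y t - \<alpha>\<^sup>2 *\<^sub>R laplace A1 A2 v x y t = u x y t \<and>
        fst (dx u x y t) + snd (dy A1 A2 u x y t) = 0 \<and>
        fst (dx v x y t) + snd (dy A1 A2 v x y t) = 0) \<and>
     (\<forall>x t. \<forall>(y, n)\<in>walls A1 A2.
        v x y t \<bullet> n = 0 \<and> (\<exists>r. dir_deriv A1 A2 n v x y t = r *\<^sub>R n))"

definition steady_alpha_euler ::
    "real \<Rightarrow> real \<Rightarrow> real \<Rightarrow> (real \<Rightarrow> real \<Rightarrow> real \<times> real) \<Rightarrow> (real \<Rightarrow> real \<Rightarrow> real \<times> real)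
      \<Rightarrow> (real \<Rightarrow> real \<Rightarrow> real) \<Rightarrow> bool" where
  "steady_alpha_euler \<alpha> A1 A2 u v p \<longleftrightarrow>
     alpha_euler \<alpha> A1 A2 (\<lambda>x y t. u x y) (\<lambda>x y t. v x y) (\<lambda>x y t. p x y)"


section \<open>The linearized stream function equation\<close>

text \<open>For \<open>\<phi> \<in> H\<^sup>4\<close> the function \<open>\<psi>\<close> is only in \<open>H\<^sup>2\<close>, so the second \<open>y\<close>-derivative in the Laplacian
  is the weak one and the equations are required for almost every \<open>y\<close>. The dependence of the fields
  on \<open>x\<close> and \<open>t\<close> is smooth.\<close>

definition weak_laplace :: "real \<Rightarrow> real \<Rightarrow> complex field \<Rightarrow> complex field" where
  "weak_laplace A1 A2 F = (\<lambda>x y t. dx (dx F) x y t + weak_deriv A1 A2 2 (\<lambda>s. F x s t) y)"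

definition linearized_stream_eq ::
    "real \<Rightarrow> real \<Rightarrow> real \<Rightarrow> (real \<Rightarrow> real) \<Rightarrow> (real \<Rightarrow> real) \<Rightarrow> complex field \<Rightarrow> complex field \<Rightarrow> bool"
where
  "linearized_stream_eq \<alpha> A1 A2 V U \<psi> \<phi> \<longleftrightarrow>
     (\<forall>x t. AE y in lebesgue_on {A1<..<A2}.
        weak_laplace A1 A2 (dt \<psi>) x y t
          + of_real (V y) * weak_laplace A1 A2 (dx \<psi>) x y t
          - of_real (ivl_deriv A1 A2 2 U y) * dx \<phi> x y t = 0 \<and>
        \<psi> x y t = \<phi> x y t - of_real (\<alpha>\<^sup>2) * weak_laplace A1 A2 \<phi> x y t)"

text \<open>The traces on the walls are pointwise values; \<open>\<phi>\<close> is meant to be \<open>C\<^sup>2\<close> up to the boundary in \<open>y\<close>,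
  as is the continuous representative of an \<open>H\<^sup>4\<close> function.\<close>

definition stream_boundary_cond :: "real \<Rightarrow> real \<Rightarrow> complex field \<Rightarrow> bool" where
  "stream_boundary_cond A1 A2 \<phi> \<longleftrightarrow>
     (\<forall>x t. \<forall>(y, n)\<in>walls A1 A2.
        dot2 (grad A1 A2 \<phi> x y t) tangent = 0 \<and>
        dot2 (dir_deriv A1 A2 n (\<lambda>x y t. - perp_grad A1 A2 \<phi> x y t) x y t) tangent = 0)"

definition normal_mode :: "real \<Rightarrow> complex \<Rightarrow> (real \<Rightarrow> complex) \<Rightarrow> complex field" where
  "normal_mode k c f = (\<lambda>x y t. f y * exp (\<i> * of_real k * (of_real x - c * of_real t)))"


section \<open>Shear flows are steady states\<close>

text \<open>The lemma \<open>shear_steady_alpha_euler\<close> below shows that the shear flow with profile \<open>V\<close> always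
  solves the equations, so assuming \<open>steady_alpha_euler\<close> for it is no restriction.\<close>

lemma ivl_deriv_Suc:
  "ivl_deriv a b (Suc n) f y = vector_derivative (ivl_deriv a b n f) (at y within {a..b})"
  by (simp add: ivl_deriv_def)

lemma ivl_deriv_has_vector_derivative:
  assumes "smooth_on_ivl a b f" "y \<in> {a..b}"
  shows "(ivl_deriv a b n f has_vector_derivative ivl_deriv a b (Suc n) f y) (at y within {a..b})"
  using assms by (simp add: smooth_on_ivl_def ivl_deriv_Suc vector_derivative_works)

lemma dy_eq:
  assumes "A1 < A2" "y \<in> {A1..A2}"
    and "\<And>s. s \<in> {A1..A2} \<Longrightarrow> F x s t = f s"
    and "(f has_vector_derivative d) (at y within {A1..A2})"
  shows "dy A1 A2 F x y t = d"
proof -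
  have "((\<lambda>s. F x s t) has_vector_derivative d) (at y within {A1..A2})"
    using has_vector_derivative_transform[OF assms(2) _ assms(4)] assms(3) by metis
  then show ?thesis
    unfolding dy_def using vector_derivative_within_cbox[of A1 A2 y] assms(1,2) by simp
qed

lemma shear_steady_alpha_euler:
  assumes "A1 < A2" and V: "smooth_on_ivl A1 A2 V"
    and V1: "ivl_deriv A1 A2 1 V A1 = 0" "ivl_deriv A1 A2 1 V A2 = 0"
    and U: "\<And>y. y \<in> {A1..A2} \<Longrightarrow> U y = V y - \<alpha>\<^sup>2 * ivl_deriv A1 A2 2 V y"
  shows "steady_alpha_euler \<alpha> A1 A2 (\<lambda>x y. (U y, 0)) (\<lambda>x y. (V y, 0))
           (\<lambda>x y. p0 - (V y)\<^sup>2 / 2 + \<alpha>\<^sup>2 / 2 * (ivl_deriv A1 A2 1 V y)\<^sup>2)"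
proof -
  let ?D = "\<lambda>n. ivl_deriv A1 A2 n V"
  note der = ivl_deriv_has_vector_derivative[OF V]
  have d0: "(V has_vector_derivative ?D 1 y) (at y within {A1..A2})" if "y \<in> {A1..A2}" for y
    using der[OF that, of 0] by (simp add: ivl_deriv_def)
  have d1: "(?D 1 has_vector_derivative ?D 2 y) (at y within {A1..A2})" if "y \<in> {A1..A2}" for y
    using der[OF that, of 1] by (simp add: numeral_2_eq_2)
  have d2: "(?D 2 has_vector_derivative ?D 3 y) (at y within {A1..A2})" if "y \<in> {A1..A2}" for y
    using der[OF that, of 2] by (simp add: numeral_3_eq_3 numeral_2_eq_2)
  have dyv: "dy A1 A2 (\<lambda>x y t. (V y, 0::real)) x y t = (?D 1 y, 0)" if "y \<in> {A1..A2}" for x y t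
    by (rule dy_eq[OF assms(1) that refl has_vector_derivative_Pair[OF d0[OF that] has_vector_derivative_const]])
  have dyyv: "dy A1 A2 (dy A1 A2 (\<lambda>x y t. (V y, 0::real))) x y t = (?D 2 y, 0)"
    if "y \<in> {A1..A2}" for x y t
    by (rule dy_eq[OF assms(1) that, of _ _ _ "\<lambda>y. (?D 1 y, 0)"])
       (rule dyv, assumption, rule has_vector_derivative_Pair[OF d1[OF that] has_vector_derivative_const])
  have dyu: "dy A1 A2 (\<lambda>x y t. (U y, 0::real)) x y t = (?D 1 y - \<alpha>\<^sup>2 * ?D 3 y, 0)"
    if "y \<in> {A1..A2}" for x y t
    by (rule dy_eq[OF assms(1) that, of _ _ _ "\<lambda>y. (V y - \<alpha>\<^sup>2 * ?D 2 y, 0)"])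
       (use U that in \<open>auto intro!: has_vector_derivative_Pair has_vector_derivative_diff
          has_vector_derivative_mult_right d0[unfolded One_nat_def] d2
          has_vector_derivative_const\<close>)
  have dyp: "dy A1 A2 (\<lambda>x y t. p0 - (V y)\<^sup>2 / 2 + \<alpha>\<^sup>2 / 2 * (?D 1 y)\<^sup>2) x y t
      = - V y * ?D 1 y + \<alpha>\<^sup>2 * ?D 1 y * ?D 2 y" if "y \<in> {A1..A2}" for x y t
  proof (rule dy_eq[OF assms(1) that refl])
    have "(V has_real_derivative ?D 1 y) (at y within {A1..A2})"
         "(?D 1 has_real_derivative ?D 2 y) (at y within {A1..A2})"
      using d0[OF that] d1[OF that] by (simp_all add: has_real_derivative_iff_has_vector_derivative)
    then have "((\<lambda>y. p0 - (V y)\<^sup>2 / 2 + \<alpha>\<^sup>2 / 2 * (?D 1 y)\<^sup>2) has_real_derivative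
        - V y * ?D 1 y + \<alpha>\<^sup>2 * ?D 1 y * ?D 2 y) (at y within {A1..A2})"
      by (auto intro!: derivative_eq_intros)
    then show "((\<lambda>y. p0 - (V y)\<^sup>2 / 2 + \<alpha>\<^sup>2 / 2 * (?D 1 y)\<^sup>2) has_vector_derivative
        - V y * ?D 1 y + \<alpha>\<^sup>2 * ?D 1 y * ?D 2 y) (at y within {A1..A2})"
      by (simp add: has_real_derivative_iff_has_vector_derivative)
  qed
  have dx0: "dx (\<lambda>x y t. f y) = (\<lambda>x y t. 0)" for f :: "real \<Rightarrow> 'b::real_normed_vector"
    by (simp add: dx_def vector_derivative_const_at)
  have dt0: "dt (\<lambda>x y t. f y) = (\<lambda>x y t. 0)" for f :: "real \<Rightarrow> 'b::real_normed_vector"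
    by (simp add: dt_def vector_derivative_const_at)
  have ends: "A1 \<in> {A1..A2}" "A2 \<in> {A1..A2}" using assms(1) by auto
  show ?thesis
    unfolding steady_alpha_euler_def alpha_euler_def
  proof (intro conjI allI ballI)
    fix x t y assume y: "y \<in> {A1..A2}"
    show "dt (\<lambda>x y t. (U y, 0::real)) x y t
            + dir_deriv A1 A2 (V y, 0) (\<lambda>x y t. (U y, 0::real)) x y t
            + ((U y, 0) \<bullet> dx (\<lambda>x y t. (V y, 0::real)) x y t,
               (U y, 0) \<bullet> dy A1 A2 (\<lambda>x y t. (V y, 0::real)) x y t)
            + grad A1 A2 (\<lambda>x y t. p0 - (V y)\<^sup>2 / 2 + \<alpha>\<^sup>2 / 2 * (?D 1 y)\<^sup>2) x y t = 0"
      unfolding dir_deriv_def grad_def dx0 dt0 dyv[OF y] dyp[OF y] U[OF y]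
      by (simp add: algebra_simps zero_prod_def)
    show "(V y, 0) - \<alpha>\<^sup>2 *\<^sub>R laplace A1 A2 (\<lambda>x y t. (V y, 0::real)) x y t = (U y, 0)"
      unfolding laplace_def dx0 dyyv[OF y] U[OF y] by (simp add: zero_prod_def)
    show "fst (dx (\<lambda>x y t. (U y, 0::real)) x y t) + snd (dy A1 A2 (\<lambda>x y t. (U y, 0::real)) x y t) = 0"
      unfolding dx0 dyu[OF y] by simp
    show "fst (dx (\<lambda>x y t. (V y, 0::real)) x y t) + snd (dy A1 A2 (\<lambda>x y t. (V y, 0::real)) x y t) = 0"
      unfolding dx0 dyv[OF y] by simp
  next
    fix x t w assume "w \<in> walls A1 A2"
    then show "case w of (y, n) \<Rightarrow> (V y, 0) \<bullet> n = 0 \<and>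
        (\<exists>r. dir_deriv A1 A2 n (\<lambda>x y t. (V y, 0::real)) x y t = r *\<^sub>R n)"
      using V1 by (auto simp: walls_def dir_deriv_def dx0 dyv[OF ends(1)] dyv[OF ends(2)]
          simp flip: zero_prod_def intro!: exI[of _ 0])
  qed
qed

end

theory Submission
  imports Defs
begin

text \<open>Multiply the Rayleigh type equation
  \<open>(V - c) (\<psi>'' - k\<^sup>2 \<psi>) = U'' \<phi>\<close> by \<open>cnj \<phi> / (V - c)\<close> and integrate. Since \<open>\<phi>\<close> and \<open>\<phi>''\<close>
  vanish on the walls, integration by parts gives \<open>\<integral> U'' |\<phi>|\<^sup>2 / (V - c) = - Q\<close> with a positive real \<open>Q\<close>.
  As \<open>Im c > 0\<close>, a suitable combination of real and imaginary part yields
  \<open>\<integral> U'' (V - l) |\<phi>|\<^sup>2 / |V - c|\<^sup>2 = - Q < 0\<close> for every real \<open>l\<close>, so \<open>U'' (V - l)\<close> is negative somewhere.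
  With \<open>l\<close> below and above the range of \<open>V\<close> this also shows that \<open>U''\<close> changes sign and thus vanishes.
  Regularity is not an issue: the equation expresses the weak fourth derivative of \<open>\<phi>\<close> through the
  continuous representatives of \<open>\<phi>\<close> and its second derivative, so that \<open>\<phi>\<close> is \<open>C\<^sup>4\<close> up to the
  boundary in the classical sense.\<close>


section \<open>Smooth functions and test functions\<close>

definition smooth_fun :: "(real \<Rightarrow> real) \<Rightarrow> bool" where
  "smooth_fun f \<longleftrightarrow> (\<forall>n x. (deriv ^^ n) f differentiable (at x))"

text \<open>All iterated derivatives of a member stay in \<open>S\<close>, so a class closed under
  differentiation contains only smooth functions. This spares any formula for the n-th
  derivative.\<close>

lemma smooth_funI_closed:
  assumes "f \<in> S" and S: "\<And>f. f \<in> S \<Longrightarrow> \<exists>g\<in>S. \<forall>x. (f has_real_derivative g x) (at x)"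
  shows "smooth_fun f"
proof -
  have der: "deriv f \<in> S" "f differentiable (at x)" if "f \<in> S" for f x
  proof -
    obtain g where g: "g \<in> S" "\<forall>x. (f has_real_derivative g x) (at x)"
      using S \<open>f \<in> S\<close> by blast
    then have "deriv f = g" using DERIV_imp_deriv by blast
    then show "deriv f \<in> S" "f differentiable (at x)"
      using g by (auto simp: real_differentiable_def)
  qed
  have "(deriv ^^ n) f \<in> S" for n
    by (induction n) (use assms(1) der in auto)
  then show ?thesis by (simp add: smooth_fun_def der)
qed

lemma smooth_fun_deriv:
  assumes "smooth_fun f"
  shows "smooth_fun (deriv f)"
  unfolding smooth_fun_def
proof (intro allI)
  fix n x
  show "(deriv ^^ n) (deriv f) differentiable at x"
    using assms[unfolded smooth_fun_def, rule_format, of "Suc n" x] by (simp only: funpow_Suc_right o_apply)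
qed

lemma smooth_fun_has_deriv:
  assumes "smooth_fun f"
  shows "(f has_real_derivative deriv f x) (at x)"
  using assms[unfolded smooth_fun_def, rule_format, of 0 x]
  by (simp add: DERIV_deriv_iff_real_differentiable)

lemma smooth_fun_antideriv:
  assumes "\<And>x. (f has_real_derivative g x) (at x)" "smooth_fun g"
  shows "smooth_fun f"
proof -
  have "deriv f = g" using assms(1) DERIV_imp_deriv by blast
  then have "(deriv ^^ n) f differentiable (at x)" for n x
    using assms by (cases n) (auto simp: real_differentiable_def smooth_fun_def funpow_Suc_right simp del: funpow.simps)
  then show ?thesis by (simp add: smooth_fun_def)
qed

lemma smooth_fun_add_scale:
  assumes "smooth_fun f" "smooth_fun g"
  shows "smooth_fun (\<lambda>x. f x + c * g x)"
proof (rule smooth_funI_closed[where S = "{\<lambda>x. f x + c * g x | f g. smooth_fun f \<and> smooth_fun g}"])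
  fix h assume "h \<in> {\<lambda>x. f x + c * g x | f g. smooth_fun f \<and> smooth_fun g}"
  then obtain f g where h: "h = (\<lambda>x. f x + c * g x)" "smooth_fun f" "smooth_fun g" by blast
  have "(h has_real_derivative deriv f x + c * deriv g x) (at x)" for x
    unfolding h(1) by (intro DERIV_add DERIV_cmult smooth_fun_has_deriv h)
  then show "\<exists>g\<in>{\<lambda>x. f x + c * g x | f g. smooth_fun f \<and> smooth_fun g}. \<forall>x. (h has_real_derivative g x) (at x)"
    using smooth_fun_deriv[OF h(2)] smooth_fun_deriv[OF h(3)]
    by (intro bexI[of _ "\<lambda>x. deriv f x + c * deriv g x"]) auto
qed (use assms in blast)


text \<open>The functions \<open>p(1/x) exp(-1/x)\<close> are closed under differentiation, which gives smoothness of the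
  bump functions built from \<open>exp(-1/x)\<close>.\<close>

definition flat :: "real poly \<Rightarrow> real \<Rightarrow> real" where
  "flat p x = (if x > 0 then poly p (1 / x) * exp (- (1 / x)) else 0)"

text \<open>The substitution y = 1/x turns the claim into the decay of p(y) exp(-y) as y tends to
  infinity.\<close>

lemma flat_tendsto_0: "(flat p \<longlongrightarrow> 0) (at_right 0)"
proof -
  have "((\<lambda>y. \<Sum>i\<le>degree p. coeff p i * (y ^ i / exp y)) \<longlongrightarrow> (\<Sum>i\<le>degree p. coeff p i * 0)) at_top"
    by (intro tendsto_sum tendsto_mult tendsto_const tendsto_power_div_exp_0)
  then have "((\<lambda>y. poly p y * exp (- y)) \<longlongrightarrow> 0) at_top"
    by (simp add: poly_altdef sum_distrib_right exp_minus divide_inverse mult.assoc)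
  from filterlim_compose[OF this filterlim_inverse_at_top_right]
  show ?thesis
    by (rule Lim_transform_eventually)
      (auto simp: eventually_at_filter flat_def inverse_eq_divide)
qed

text \<open>The polynomial \<open>[:0, 0, 1:]\<close> stands for the factor 1/x^2 of the chain rule.
  The exponential contributes \<open>p\<close> and the inner polynomial contributes
  \<open>- pderiv p\<close>.\<close>

lemma flat_has_derivative:
  "(flat p has_real_derivative flat ([:0, 0, 1:] * (p - pderiv p)) x) (at x)"
proof -
  consider "x > 0" | "x < 0" | "x = 0" by linarith
  then show ?thesis
  proof cases
    case 1
    have "((\<lambda>x. poly p (1 / x) * exp (- (1 / x))) has_real_derivative
        flat ([:0, 0, 1:] * (p - pderiv p)) x) (at x)"
      using 1 by (auto intro!: derivative_eq_intros DERIV_chain2[OF poly_DERIV]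
          simp: flat_def field_simps power2_eq_square)
    then show ?thesis
      by (rule has_field_derivative_transform_within_open[of _ _ _ "{0<..}"])
         (use 1 in \<open>auto simp: flat_def\<close>)
  next
    case 2
    have "((\<lambda>x. 0) has_real_derivative 0) (at x)" by simp
    then have "(flat p has_real_derivative 0) (at x)"
      by (rule has_field_derivative_transform_within_open[of _ _ _ "{..<0}"])
         (use 2 in \<open>auto simp: flat_def\<close>)
    then show ?thesis using 2 by (simp add: flat_def)
  next
    case 3
    \<comment> \<open>For h > 0, dividing by h multiplies the polynomial in 1/h by its variable, so
      the difference quotient at 0 is again a flat function.\<close>
    have "((\<lambda>h. flat p h / h) \<longlongrightarrow> 0) (at_right 0)"
      by (rule Lim_transform_eventually[OF flat_tendsto_0[of "[:0, 1:] * p"]])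
         (auto simp: eventually_at_filter flat_def)
    moreover have "((\<lambda>h. flat p h / h) \<longlongrightarrow> 0) (at_left 0)"
      by (rule tendsto_eventually) (auto simp: eventually_at_filter flat_def)
    ultimately have "((\<lambda>h. flat p h / h) \<longlongrightarrow> 0) (at 0)"
      by (simp add: filterlim_split_at)
    then show ?thesis using 3 by (simp add: DERIV_def flat_def)
  qed
qed

text \<open>Affine arguments are part of the generators, since the inner derivative \<open>m\<close>
  can be absorbed into the polynomial. Products are included because a bump function is a product of
  two flat functions.\<close>

inductive_set flat_algebra :: "(real \<Rightarrow> real) set" where
  flat: "(\<lambda>x. flat p (m * x + c)) \<in> flat_algebra"
| add: "f \<in> flat_algebra \<Longrightarrow> g \<in> flat_algebra \<Longrightarrow> (\<lambda>x. f x + g x) \<in> flat_algebra"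
| mult: "f \<in> flat_algebra \<Longrightarrow> g \<in> flat_algebra \<Longrightarrow> (\<lambda>x. f x * g x) \<in> flat_algebra"

lemma flat_algebra_has_derivative:
  "f \<in> flat_algebra \<Longrightarrow> \<exists>g\<in>flat_algebra. \<forall>x. (f has_real_derivative g x) (at x)"
proof (induction rule: flat_algebra.induct)
  case (flat p m c)
  have "((\<lambda>x. flat p (m * x + c)) has_real_derivative
      flat (smult m ([:0, 0, 1:] * (p - pderiv p))) (m * x + c)) (at x)" for x
    by (rule DERIV_cong[OF DERIV_chain2[OF flat_has_derivative, where Db = m]])
       (auto intro!: derivative_eq_intros simp: flat_def algebra_simps)
  then show ?case
    by (intro bexI[OF _ flat_algebra.flat[of "smult m ([:0, 0, 1:] * (p - pderiv p))" m c]]) simp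
next
  case (add f g)
  then show ?case by (fastforce intro!: flat_algebra.add DERIV_add)
next
  case (mult f g)
  then obtain f' g' where f': "f' \<in> flat_algebra" "\<forall>x. (f has_real_derivative f' x) (at x)"
    and g': "g' \<in> flat_algebra" "\<forall>x. (g has_real_derivative g' x) (at x)" by blast
  have "((\<lambda>x. f x * g x) has_real_derivative f' x * g x + g' x * f x) (at x)" for x
    using f'(2) g'(2) by (intro DERIV_mult) auto
  then show ?case
    using flat_algebra.add[OF flat_algebra.mult[OF f'(1) mult.hyps(2)] flat_algebra.mult[OF g'(1) mult.hyps(1)]]
    by (intro bexI[of _ "\<lambda>x. f' x * g x + g' x * f x"]) auto
qed

lemma smooth_fun_flat_algebra: "f \<in> flat_algebra \<Longrightarrow> smooth_fun f"
  by (rule smooth_funI_closed[OF _ flat_algebra_has_derivative])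

section \<open>Test functions as smooth functions that vanish outside a compact subinterval\<close>

lemma test_function_iff:
  "test_function a b \<eta> \<longleftrightarrow> smooth_fun \<eta> \<and> (\<exists>r s. a < r \<and> s < b \<and> (\<forall>x. x \<notin> {r..s} \<longrightarrow> \<eta> x = 0))"
proof -
  let ?K = "closure {x. \<eta> x \<noteq> 0}"
  have "(compact ?K \<and> ?K \<subseteq> {a<..<b}) \<longleftrightarrow> (\<exists>r s. a < r \<and> s < b \<and> (\<forall>x. x \<notin> {r..s} \<longrightarrow> \<eta> x = 0))"
  proof
    assume K: "compact ?K \<and> ?K \<subseteq> {a<..<b}"
    show "\<exists>r s. a < r \<and> s < b \<and> (\<forall>x. x \<notin> {r..s} \<longrightarrow> \<eta> x = 0)"
    proof (cases "?K = {}")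
      case True
      then show ?thesis by (intro exI[of _ "a + 1"] exI[of _ "b - 1"]) auto
    next
      case False
      \<comment> \<open>The end points are the minimum and the maximum of the compact support, hence
        they lie strictly between \<open>a\<close> and \<open>b\<close>.\<close>
      obtain r where r: "r \<in> ?K" "\<And>x. x \<in> ?K \<Longrightarrow> r \<le> x"
        using compact_attains_inf[OF _ False] K by blast
      obtain s where s: "s \<in> ?K" "\<And>x. x \<in> ?K \<Longrightarrow> x \<le> s"
        using compact_attains_sup[OF _ False] K by blast
      have "\<eta> x = 0" if "x \<notin> {r..s}" for x
        using that r(2)[of x] s(2)[of x] closure_subset[of "{x. \<eta> x \<noteq> 0}"] by auto
      then show ?thesis using r(1) s(1) K by (intro exI[of _ r] exI[of _ s]) auto
    qed
  next
    assume "\<exists>r s. a < r \<and> s < b \<and> (\<forall>x. x \<notin> {r..s} \<longrightarrow> \<eta> x = 0)"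
    then obtain r s where rs: "a < r" "s < b" "\<And>x. x \<notin> {r..s} \<Longrightarrow> \<eta> x = 0" by blast
    have K: "?K \<subseteq> {r..s}" by (rule closure_minimal) (use rs(3) in blast, simp)
    then have "compact ?K"
      by (metis bounded_closed_interval bounded_subset closed_closure compact_eq_bounded_closed)
    with K rs show "compact ?K \<and> ?K \<subseteq> {a<..<b}" by auto
  qed
  then show ?thesis by (simp add: test_function_def smooth_fun_def)
qed

lemma test_function_deriv:
  assumes "test_function a b \<eta>"
  shows "test_function a b (deriv \<eta>)"
proof -
  obtain r s where rs: "a < r" "s < b" "\<And>x. x \<notin> {r..s} \<Longrightarrow> \<eta> x = 0" and sm: "smooth_fun \<eta>"
    using assms unfolding test_function_iff by blast
  have "deriv \<eta> x = 0" if "x \<notin> {r..s}" for x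
  proof (rule DERIV_imp_deriv)
    have "((\<lambda>x. 0) has_real_derivative 0) (at x)" by simp
    then show "(\<eta> has_real_derivative 0) (at x)"
      by (rule has_field_derivative_transform_within_open[of _ _ _ "- {r..s}"])
         (use that rs(3) in \<open>auto simp: open_Compl\<close>)
  qed
  then show ?thesis using smooth_fun_deriv[OF sm] rs unfolding test_function_iff by blast
qed

lemma test_function_add_scale:
  assumes "test_function a b f" "test_function a b g"
  shows "test_function a b (\<lambda>x. f x + c * g x)"
proof -
  obtain r s where 1: "a < r" "s < b" "\<And>x. x \<notin> {r..s} \<Longrightarrow> f x = 0"
    using assms(1) unfolding test_function_iff by blast
  obtain r' s' where 2: "a < r'" "s' < b" "\<And>x. x \<notin> {r'..s'} \<Longrightarrow> g x = 0"
    using assms(2) unfolding test_function_iff by blast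
  have "\<forall>x. x \<notin> {min r r'..max s s'} \<longrightarrow> f x + c * g x = 0"
  proof (intro allI impI)
    fix x assume "x \<notin> {min r r'..max s s'}"
    then have "x \<notin> {r..s}" "x \<notin> {r'..s'}" by auto
    then show "f x + c * g x = 0" using 1(3) 2(3) by simp
  qed
  moreover have "a < min r r'" "max s s' < b" using 1 2 by auto
  ultimately show ?thesis
    using smooth_fun_add_scale assms unfolding test_function_iff by blast
qed

text \<open>Stretching the two flat factors by n + 1 pushes the exponents to 0 at each point of
  (r,s), so these test functions converge pointwise to the indicator function of (r,s).\<close>

lemma bump_sequence:
  fixes a b r s :: real
  assumes "a < r" "s < b"
  obtains \<eta> :: "nat \<Rightarrow> real \<Rightarrow> real" where "\<And>n. test_function a b (\<eta> n)"
    and "\<And>n x. 0 \<le> \<eta> n x" and "\<And>n x. \<eta> n x \<le> 1"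
    and "\<And>n x. x \<notin> {r<..<s} \<Longrightarrow> \<eta> n x = 0"
    and "\<And>x. x \<in> {r<..<s} \<Longrightarrow> (\<lambda>n. \<eta> n x) \<longlonglongrightarrow> 1"
    and "\<And>n x. x \<in> {r<..<s} \<Longrightarrow> 0 < \<eta> n x"
proof -
  \<comment> \<open>The arguments are written as \<open>m * x + c\<close> to match the generators of
    \<open>flat_algebra\<close>; the fact \<open>eq\<close> gives the readable form.\<close>
  define \<eta> where "\<eta> n x = flat 1 (real (Suc n) * x + - (real (Suc n) * r)) *
      flat 1 (- real (Suc n) * x + real (Suc n) * s)" for n x
  have eq: "\<eta> n x = flat 1 (real (Suc n) * (x - r)) * flat 1 (real (Suc n) * (s - x))" for n x
    by (simp add: \<eta>_def algebra_simps)
  have pos: "0 < real (Suc n) * y \<longleftrightarrow> 0 < y" for n y by (simp add: zero_less_mult_iff)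
  have f01: "0 \<le> flat 1 x" "flat 1 x \<le> 1" for x by (auto simp: flat_def)
  have sm: "smooth_fun (\<eta> n)" for n
    unfolding \<eta>_def by (intro smooth_fun_flat_algebra flat_algebra.mult flat_algebra.flat)
  have z: "\<eta> n x = 0" if "x \<notin> {r<..<s}" for n x
    using that unfolding eq flat_def pos by auto
  have lim: "(\<lambda>n. flat 1 (real (Suc n) * y)) \<longlonglongrightarrow> 1" if "y > 0" for y
  proof -
    have "(\<lambda>n. exp (- (inverse (real (Suc n)) * (1 / y)))) \<longlonglongrightarrow> exp (- (0 * (1 / y)))"
      by (intro tendsto_intros LIMSEQ_inverse_real_of_nat)
    then show ?thesis using that by (simp add: flat_def divide_inverse mult.commute pos)
  qed
  show ?thesis
  proof (rule that[of \<eta>])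
    show "test_function a b (\<eta> n)" for n
      unfolding test_function_iff using assms sm z[of _ n]
      by (intro conjI exI[of _ r] exI[of _ s]) auto
    show "(\<lambda>n. \<eta> n x) \<longlonglongrightarrow> 1" if "x \<in> {r<..<s}" for x
      using tendsto_mult[OF lim[of "x - r"] lim[of "s - x"]] that unfolding eq by simp
    show "0 < \<eta> n x" if "x \<in> {r<..<s}" for n x
      using that unfolding eq flat_def pos by (auto intro!: mult_pos_pos)
  qed (use f01 z in \<open>auto simp: eq mult_le_one\<close>)
qed


section \<open>The fundamental lemma of the calculus of variations\<close>

text \<open>By Lebesgue differentiation, \<open>h x\<close> is for almost every x the limit of the
  means of \<open>h\<close> over [x, x + t], and all these means vanish.\<close>

lemma negligible_nonzero_if_integrals_zero:
  fixes h :: "real \<Rightarrow> 'a::euclidean_space"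
  assumes int: "\<And>r s. a < r \<Longrightarrow> s < b \<Longrightarrow> h absolutely_integrable_on {r..s}"
    and zero: "\<And>r s. a < r \<Longrightarrow> s < b \<Longrightarrow> integral {r..s} h = 0"
  shows "negligible {x\<in>{a<..<b}. h x \<noteq> 0}"
proof -
  have *: "negligible {x\<in>{r..s}. h x \<noteq> 0}" if rs: "a < r" "s < b" for r s
  proof -
    \<comment> \<open>Extension by zero gives a function integrable over every interval; its
      integrals reduce to integrals of \<open>h\<close> over subintervals of {r..s}.\<close>
    let ?H = "\<lambda>x. if x \<in> {r..s} then h x else 0"
    have "?H absolutely_integrable_on UNIV"
      using int[OF rs] by (simp only: absolutely_integrable_restrict_UNIV)
    then have intH: "?H integrable_on cbox u v" for u v
      using integrable_on_subcbox set_lebesgue_integral_eq_integral(1) by blast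
    have H0: "integral (cbox u v) ?H = 0" for u v
    proof -
      have "integral (cbox u v) ?H = integral ({u..v} \<inter> {r..s}) h"
        by (simp only: Henstock_Kurzweil_Integration.integral_restrict_Int Int_commute box_real)
      also have "{u..v} \<inter> {r..s} = {max u r..min v s}" by auto
      also have "integral {max u r..min v s} h = 0" using rs by (intro zero) auto
      finally show ?thesis .
    qed
    obtain N where N: "negligible N" "\<And>x e. x \<notin> N \<Longrightarrow> 0 < e \<Longrightarrow> \<exists>d>0. \<forall>t. 0 < t \<and> t < d \<longrightarrow>
        norm (integral (cbox x (x + t *\<^sub>R One)) ?H /\<^sub>R t ^ DIM(real) - ?H x) < e"
      using integrable_ccontinuous_explicit[OF intH] by blast
    have "?H x = 0" if x: "x \<notin> N" for x
    proof (rule ccontr)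
      assume "?H x \<noteq> 0"
      then obtain d where d: "d > 0" "\<And>t. 0 < t \<and> t < d \<Longrightarrow>
          norm (integral (cbox x (x + t *\<^sub>R One)) ?H /\<^sub>R t ^ DIM(real) - ?H x) < norm (?H x)"
        using N(2)[OF x, of "norm (?H x)"] by auto
      from d(2)[of "d / 2"] d(1) show False unfolding H0 by simp
    qed
    then have "{x\<in>{r..s}. h x \<noteq> 0} \<subseteq> N" by fastforce
    then show ?thesis using N(1) negligible_subset by blast
  qed
  \<comment> \<open>Integrability is known only away from \<open>a\<close> and \<open>b\<close>, so
    the open interval is exhausted by countably many compact ones.\<close>
  have "{x\<in>{a<..<b}. h x \<noteq> 0} \<subseteq> (\<Union>n. {x\<in>{a + 1 / real (Suc n)..b - 1 / real (Suc n)}. h x \<noteq> 0})"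
  proof
    fix x assume x: "x \<in> {x\<in>{a<..<b}. h x \<noteq> 0}"
    then obtain n where "1 / real (Suc n) < min (x - a) (b - x)"
      using nat_approx_posE[of "min (x - a) (b - x)"] by auto
    then show "x \<in> (\<Union>n. {x\<in>{a + 1 / real (Suc n)..b - 1 / real (Suc n)}. h x \<noteq> 0})"
      using x by (auto intro!: exI[of _ n])
  qed
  moreover have "negligible (\<Union>n. {x\<in>{a + 1 / real (Suc n)..b - 1 / real (Suc n)}. h x \<noteq> 0})"
    by (intro negligible_Union_nat *) auto
  ultimately show ?thesis using negligible_subset by blast
qed

lemma absolutely_integrable_continuous_scaleR:
  fixes f :: "real \<Rightarrow> 'a::euclidean_space"
  assumes "continuous_on {a..b} \<eta>" "f absolutely_integrable_on {a..b}"
  shows "(\<lambda>x. \<eta> x *\<^sub>R f x) absolutely_integrable_on {a..b}"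
proof (rule absolutely_integrable_bounded_measurable_product[where h = scaleR, OF _ _ _ _ assms(2)])
  show "bilinear (scaleR :: real \<Rightarrow> 'a \<Rightarrow> 'a)"
    by (auto simp: bilinear_def linear_iff algebra_simps)
  show "\<eta> \<in> borel_measurable (lebesgue_on {a..b})"
    using assms(1) by (simp add: continuous_imp_measurable_on_sets_lebesgue)
  show "{a..b} \<in> sets lebesgue" by simp
  show "bounded (\<eta> ` {a..b})"
    using assms(1) compact_continuous_image compact_imp_bounded by blast
qed

lemma test_function_continuous: "test_function a b \<eta> \<Longrightarrow> continuous_on S \<eta>"
  unfolding test_function_iff
  by (meson DERIV_continuous continuous_at_imp_continuous_on smooth_fun_has_deriv)

text \<open>Local integrability of \<open>f\<close> suffices because \<eta> vanishes near both end
  points.\<close>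

lemma test_function_scaleR_integrable:
  fixes f :: "real \<Rightarrow> 'a::euclidean_space"
  assumes "\<And>r s. a < r \<Longrightarrow> s < b \<Longrightarrow> f absolutely_integrable_on {r..s}" "test_function a b \<eta>"
  shows "(\<lambda>x. \<eta> x *\<^sub>R f x) absolutely_integrable_on {a<..<b}"
proof -
  obtain r s where rs: "a < r" "s < b" "\<And>x. x \<notin> {r..s} \<Longrightarrow> \<eta> x = 0"
    using assms(2) unfolding test_function_iff by blast
  have "(\<lambda>x. \<eta> x *\<^sub>R f x) absolutely_integrable_on {r..s}"
    using rs by (intro absolutely_integrable_continuous_scaleR assms test_function_continuous[OF assms(2)])
  then show ?thesis
  proof (rule absolutely_integrable_spike_set)
    have "{x \<in> {r..s} - {a<..<b}. \<eta> x *\<^sub>R f x \<noteq> 0} = {}" using rs by auto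
    then show "negligible {x \<in> {r..s} - {a<..<b}. \<eta> x *\<^sub>R f x \<noteq> 0}" by (simp only: negligible_empty)
    have "{x \<in> {a<..<b} - {r..s}. \<eta> x *\<^sub>R f x \<noteq> 0} = {}" using rs(3) by auto
    then show "negligible {x \<in> {a<..<b} - {r..s}. \<eta> x *\<^sub>R f x \<noteq> 0}" by (simp only: negligible_empty)
  qed
qed

text \<open>Test functions converging to the indicator function of (r,s) carry the hypothesis over
  to the integral of \<open>h\<close> over (r,s). Convergence is dominated by |h| on [r,s].\<close>

lemma fundamental_lemma_calculus_of_variations:
  fixes h :: "real \<Rightarrow> 'a::euclidean_space"
  assumes int: "\<And>r s. a < r \<Longrightarrow> s < b \<Longrightarrow> h absolutely_integrable_on {r..s}"
    and zero: "\<And>\<eta>. test_function a b \<eta> \<Longrightarrow> integral {a<..<b} (\<lambda>x. \<eta> x *\<^sub>R h x) = 0"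
  shows "negligible {x\<in>{a<..<b}. h x \<noteq> 0}"
proof (rule negligible_nonzero_if_integrals_zero[OF int])
  fix r s :: real assume rs: "a < r" "s < b"
  obtain \<eta> :: "nat \<Rightarrow> real \<Rightarrow> real" where \<eta>: "\<And>n. test_function a b (\<eta> n)"
    "\<And>n x. 0 \<le> \<eta> n x" "\<And>n x. \<eta> n x \<le> 1" "\<And>n x. x \<notin> {r<..<s} \<Longrightarrow> \<eta> n x = 0"
    "\<And>x. x \<in> {r<..<s} \<Longrightarrow> (\<lambda>n. \<eta> n x) \<longlonglongrightarrow> 1"
    using bump_sequence[OF rs] by metis
  have sub: "{r<..<s} \<subseteq> {a<..<b}" "{r..s} \<subseteq> {a<..<b}" using rs by auto
  let ?g = "\<lambda>x. if x \<in> {r<..<s} then h x else 0"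
  have "(\<lambda>n. integral {a<..<b} (\<lambda>x. \<eta> n x *\<^sub>R h x)) \<longlonglongrightarrow> integral {a<..<b} ?g"
  proof (rule dominated_convergence(2))
    show "(\<lambda>x. \<eta> k x *\<^sub>R h x) integrable_on {a<..<b}" for k
      using test_function_scaleR_integrable[OF int \<eta>(1)] set_lebesgue_integral_eq_integral(1) by blast
    have "(\<lambda>x. norm (h x)) integrable_on {r..s}"
      using int[OF rs] absolutely_integrable_on_def by blast
    then show "(\<lambda>x. if x \<in> {r..s} then norm (h x) else 0) integrable_on {a<..<b}"
      using sub(2) by (simp only: integrable_restrict_Int inf.absorb1)
    show "norm (\<eta> k x *\<^sub>R h x) \<le> (if x \<in> {r..s} then norm (h x) else 0)" for k x
      using \<eta>(2)[of k x] \<eta>(3)[of k x] \<eta>(4)[of x k] by (auto simp: mult_left_le_one_le)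
    show "(\<lambda>k. \<eta> k x *\<^sub>R h x) \<longlonglongrightarrow> ?g x" for x
    proof (cases "x \<in> {r<..<s}")
      case True
      then show ?thesis using tendsto_scaleR[OF \<eta>(5)[OF True] tendsto_const[of "h x"]] by simp
    next
      case False
      then show ?thesis using \<eta>(4)[OF False] by (simp only: if_False scaleR_zero_left tendsto_const)
    qed
  qed
  then have "integral {a<..<b} ?g = 0"
    by (simp only: zero[OF \<eta>(1)] LIMSEQ_const_iff)
  moreover have "integral {a<..<b} ?g = integral {r<..<s} h"
    using sub(1) by (simp only: Henstock_Kurzweil_Integration.integral_restrict_Int inf.absorb1)
  ultimately show "integral {r..s} h = 0" by (simp add: integral_open_interval_real)
qed


section \<open>Weak derivatives of integrable functions\<close>

text \<open>Integration by parts for a primitive of a function that is merely integrable. The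
  boundary term at \<open>a\<close> vanishes because the primitive starts there.\<close>

lemma integral_by_parts_indefinite:
  fixes g :: "real \<Rightarrow> 'a::euclidean_space"
  assumes ab: "a \<le> b" and g: "g absolutely_integrable_on {a..b}"
    and \<eta>: "\<And>x. x \<in> {a..b} \<Longrightarrow> (\<eta> has_real_derivative \<eta>' x) (at x within {a..b})"
    and \<eta>': "continuous_on {a..b} \<eta>'"
  shows "integral {a..b} (\<lambda>x. \<eta>' x *\<^sub>R integral {a..x} g) + integral {a..b} (\<lambda>x. \<eta> x *\<^sub>R g x)
    = \<eta> b *\<^sub>R integral {a..b} g"
proof -
  define G where "G x = integral {a..x} g" for x
  define N where "N x = integral {a..x} (\<lambda>s. norm (g s))" for x
  define F where "F x = \<eta>' x *\<^sub>R G x + \<eta> x *\<^sub>R g x" for x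
  \<comment> \<open>As \<open>G\<close> need not be differentiable everywhere, the product rule is not available. But increments of
    \<open>K\<close> are of order \<open>(y - x) * (N y - N x)\<close> with \<open>N\<close> continuous, so \<open>K\<close> is differentiable
    everywhere with derivative 0.\<close>
  define K where "K x = \<eta> x *\<^sub>R G x - integral {a..x} F" for x
  have gi: "g integrable_on {a..b}" and ni: "(\<lambda>s. norm (g s)) integrable_on {a..b}"
    using g by (auto simp: absolutely_integrable_on_def)
  have Gc: "continuous_on {a..b} G" and Nc: "continuous_on {a..b} N"
    unfolding G_def N_def using gi ni by (auto intro: indefinite_integral_continuous_1)
  have \<eta>c: "continuous_on {a..b} \<eta>"
    using \<eta> DERIV_continuous continuous_on_eq_continuous_within by blast
  have i1: "(\<lambda>x. \<eta>' x *\<^sub>R G x) integrable_on {a..b}"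
    by (intro integrable_continuous_real continuous_intros \<eta>' Gc)
  have i2: "(\<lambda>x. \<eta> x *\<^sub>R g x) integrable_on {a..b}"
    using absolutely_integrable_continuous_scaleR[OF \<eta>c g] by (simp add: absolutely_integrable_on_def)
  have Fi: "F integrable_on {a..b}" unfolding F_def by (intro integrable_add i1 i2)
  obtain M where M: "\<And>x. x \<in> {a..b} \<Longrightarrow> \<bar>\<eta>' x\<bar> \<le> M"
    using compact_imp_bounded[OF compact_continuous_image[OF \<eta>']]
    unfolding bounded_iff by (metis compact_Icc imageI real_norm_def)
  have M0: "M \<ge> 0" using M[of a] ab by auto
  have lip: "\<bar>\<eta> y - \<eta> x\<bar> \<le> M * \<bar>y - x\<bar>" if "x \<in> {a..b}" "y \<in> {a..b}" for x y
    using field_differentiable_bound[OF convex_real_interval(5) \<eta>, of M y x] M that by simp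
  have diffs: "integral {a..y} f - integral {a..x} f = integral {x..y} f"
    if "f integrable_on {a..b}" "a \<le> x" "x \<le> y" "y \<le> b" for f :: "real \<Rightarrow> 'b::euclidean_space" and x y
    using Henstock_Kurzweil_Integration.integral_combine[OF that(2,3), of f] integrable_on_subinterval[OF that(1), of a y] that
    by (simp add: diff_eq_eq add.commute)
  have est: "norm (K y - K x) \<le> 2 * M * (N y - N x) * (y - x)" if xy: "a \<le> x" "x \<le> y" "y \<le> b" for x y
  proof -
    have sub: "{x..y} \<subseteq> {a..b}" using xy by auto
    have gi': "g integrable_on {x..y}" "(\<lambda>s. norm (g s)) integrable_on {x..y}" "F integrable_on {x..y}"
      using gi ni Fi sub integrable_on_subinterval by blast+
    have i3: "\<eta>' integrable_on {x..y}" using \<eta>' sub continuous_on_subset integrable_continuous_real by blast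
    have "(\<eta>' has_integral (\<eta> y - \<eta> x)) {x..y}"
      using xy by (intro fundamental_theorem_of_calculus)
        (auto simp flip: has_real_derivative_iff_has_vector_derivative intro: DERIV_subset[OF \<eta> sub])
    then have i4: "integral {x..y} \<eta>' = \<eta> y - \<eta> x" by blast
    have "((\<lambda>s. \<eta> y *\<^sub>R g s + \<eta>' s *\<^sub>R G x - F s) has_integral
        (\<eta> y *\<^sub>R integral {x..y} g + integral {x..y} \<eta>' *\<^sub>R G x - integral {x..y} F)) {x..y}"
      using gi' i3
      by (intro has_integral_diff has_integral_add has_integral_cmul has_integral_scaleR_left integrable_integral)
    note i5 = integral_unique[OF this]
    \<comment> \<open>The increment becomes one integral over {x..y} whose integrand contains only
      the differences \<open>\<eta> y - \<eta> s\<close> and \<open>G x - G s\<close>. These are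
      bounded by \<open>M * (y - x)\<close> and \<open>N y - N x\<close>.\<close>
    have "K y - K x = \<eta> y *\<^sub>R (G y - G x) + (\<eta> y - \<eta> x) *\<^sub>R G x - (integral {a..y} F - integral {a..x} F)"
      by (simp add: K_def algebra_simps)
    also have "\<dots> = integral {x..y} (\<lambda>s. \<eta> y *\<^sub>R g s + \<eta>' s *\<^sub>R G x - F s)"
      unfolding i5 using xy by (simp add: G_def diffs[OF gi] diffs[OF Fi] flip: i4)
    also have "\<dots> = integral {x..y} (\<lambda>s. (\<eta> y - \<eta> s) *\<^sub>R g s + \<eta>' s *\<^sub>R (G x - G s))"
      by (simp add: F_def algebra_simps)
    also have "norm \<dots> \<le> integral {x..y} (\<lambda>s. M * (y - x) * norm (g s) + M * (N y - N x))"
    proof (rule integral_norm_bound_integral)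
      have "(\<lambda>s. \<eta> y *\<^sub>R g s + \<eta>' s *\<^sub>R G x - F s) integrable_on {x..y}"
        using gi' i3 by (intro integrable_diff integrable_add integrable_cmul integrable_on_scaleR_left)
      then show "(\<lambda>s. (\<eta> y - \<eta> s) *\<^sub>R g s + \<eta>' s *\<^sub>R (G x - G s)) integrable_on {x..y}"
        by (simp add: F_def algebra_simps)
      show "(\<lambda>s. M * (y - x) * norm (g s) + M * (N y - N x)) integrable_on {x..y}"
        using gi' by (intro integrable_add integrable_on_mult_right integrable_const_ivl)
      fix s assume s: "s \<in> {x..y}"
      have "norm (G s - G x) \<le> N s - N x"
        unfolding G_def N_def using s xy gi ni
        by (simp add: diffs) (intro integral_norm_bound_integral;
            use integrable_on_subinterval[of _ "{a..b}" x s] in auto)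
      also have "N s - N x \<le> N y - N x"
      proof -
        have "0 \<le> integral {s..y} (\<lambda>s. norm (g s))"
          by (intro integral_nonneg integrable_on_subinterval[OF ni]) (use s xy in auto)
        then show ?thesis using s xy diffs[OF ni, of s y] by (simp add: N_def)
      qed
      finally have "norm (\<eta>' s *\<^sub>R (G x - G s)) \<le> M * (N y - N x)"
        using M[of s] s sub M0 by (auto simp: norm_minus_commute intro!: mult_mono)
      moreover have "norm ((\<eta> y - \<eta> s) *\<^sub>R g s) \<le> M * (y - x) * norm (g s)"
      proof -
        have "\<bar>\<eta> y - \<eta> s\<bar> \<le> M * \<bar>y - s\<bar>" using lip[of s y] s xy by auto
        also have "\<dots> \<le> M * (y - x)" using s M0 by (intro mult_left_mono) auto
        finally show ?thesis by (simp add: mult_right_mono)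
      qed
      ultimately show "norm ((\<eta> y - \<eta> s) *\<^sub>R g s + \<eta>' s *\<^sub>R (G x - G s))
          \<le> M * (y - x) * norm (g s) + M * (N y - N x)"
        by (intro norm_triangle_mono)
    qed
    also have "\<dots> = M * (y - x) * integral {x..y} (\<lambda>s. norm (g s)) + M * (N y - N x) * (y - x)"
    proof (rule integral_unique)
      have "((\<lambda>s. M * (y - x) * norm (g s) + M * (N y - N x)) has_integral
          M * (y - x) * integral {x..y} (\<lambda>s. norm (g s)) + measure lborel {x..y} *\<^sub>R (M * (N y - N x))) {x..y}"
        using gi' by (intro has_integral_add has_integral_mult_right has_integral_const_real integrable_integral)
      then show "((\<lambda>s. M * (y - x) * norm (g s) + M * (N y - N x)) has_integral
          M * (y - x) * integral {x..y} (\<lambda>s. norm (g s)) + M * (N y - N x) * (y - x)) {x..y}"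
        using xy by (simp add: mult.commute)
    qed
    also have "integral {x..y} (\<lambda>s. norm (g s)) = N y - N x"
      unfolding N_def using xy diffs[OF ni] by simp
    finally show ?thesis by (simp add: algebra_simps)
  qed
  have est': "norm (K y - K x) \<le> 2 * M * \<bar>N y - N x\<bar> * \<bar>y - x\<bar>"
    if xy: "x \<in> {a..b}" "y \<in> {a..b}" for x y
  proof -
    have *: "2 * M * (N v - N u) * (v - u) \<le> 2 * M * \<bar>N v - N u\<bar> * \<bar>v - u\<bar>" if "u \<le> v" for u v
    proof -
      have "(N v - N u) * (v - u) \<le> \<bar>N v - N u\<bar> * \<bar>v - u\<bar>" using that by (simp add: mult_right_mono)
      from mult_left_mono[OF this, of "2 * M"] show ?thesis using M0 by (simp add: mult.assoc)
    qed
    show ?thesis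
    proof (cases "x \<le> y")
      case True
      then show ?thesis using est[of x y] *[of x y] xy by auto
    next
      case False
      then show ?thesis using est[of y x] *[of y x] xy by (auto simp: norm_minus_commute abs_minus_commute)
    qed
  qed
  have "(K has_derivative (\<lambda>h. 0)) (at x within {a..b})" if x: "x \<in> {a..b}" for x
    unfolding has_derivative_within_alt
  proof (intro conjI allI impI)
    fix e :: real assume e: "e > 0"
    \<comment> \<open>The summand 1 keeps the denominator positive when \<open>M\<close> is
      0.\<close>
    then have "e / (2 * M + 1) > 0" using M0 by simp
    then obtain d where d: "d > 0" "\<And>y. y \<in> {a..b} \<Longrightarrow> \<bar>y - x\<bar> < d \<Longrightarrow> \<bar>N y - N x\<bar> < e / (2 * M + 1)"
      using Nc[unfolded continuous_on_iff, rule_format, OF x, of "e / (2 * M + 1)"]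
      unfolding dist_real_def by blast
    show "\<exists>d>0. \<forall>y\<in>{a..b}. norm (y - x) < d \<longrightarrow> norm (K y - K x - 0) \<le> e * norm (y - x)"
    proof (intro exI conjI ballI impI)
      fix y assume y: "y \<in> {a..b}" "norm (y - x) < d"
      have "2 * M * \<bar>N y - N x\<bar> \<le> (2 * M + 1) * (e / (2 * M + 1))"
        using d(2)[of y] y M0 by (intro mult_mono) auto
      also have "\<dots> = e" using M0 by simp
      finally show "norm (K y - K x - 0) \<le> e * norm (y - x)"
        using est'[OF x y(1)] mult_right_mono[of "2 * M * \<bar>N y - N x\<bar>" e "\<bar>y - x\<bar>"] by auto
    qed (rule d(1))
  qed simp
  from has_derivative_zero_unique[OF convex_real_interval(5) this, of a b] ab
  have "K b = K a" by simp
  then show ?thesis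
    using i1 i2 by (simp add: K_def G_def F_def[abs_def] Henstock_Kurzweil_Integration.integral_add)
qed

section \<open>Antiderivatives of test functions and vanishing weak derivatives\<close>

lemma smooth_antiderivative:
  fixes \<theta> :: "real \<Rightarrow> real"
  assumes \<theta>: "test_function a b \<theta>"
  shows "((\<lambda>x. integral {a..x} \<theta>) has_real_derivative \<theta> x) (at x)"
proof -
  obtain r s where rs: "a < r" "s < b" "\<And>x. x \<notin> {r..s} \<Longrightarrow> \<theta> x = 0"
    using \<theta> unfolding test_function_iff by blast
  have supp: "a < t" if "\<theta> t \<noteq> 0" for t
    using rs(1) rs(3)[of t] that by (cases "t \<in> {r..s}") auto
  \<comment> \<open>Since \<theta> vanishes up to \<open>a\<close>, the lower limit can be moved to
    \<open>L\<close> below both \<open>a\<close> and \<open>x\<close>. Then \<open>x\<close> is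
    interior to {L..R} and the derivative is two-sided, also at \<open>a\<close> and outside
    {a..b}.\<close>
  define L R where "L = min a x - 1" and "R = x + 1"
  have *: "integral {L..y} \<theta> = integral {a..y} \<theta>" for y
  proof (rule integral_spike_set)
    have "{t \<in> {L..y} - {a..y}. \<theta> t \<noteq> 0} = {}" by (auto dest: supp)
    then show "negligible {t \<in> {L..y} - {a..y}. \<theta> t \<noteq> 0}" by (simp only: negligible_empty)
    have "{t \<in> {a..y} - {L..y}. \<theta> t \<noteq> 0} = {}" by (auto simp: L_def)
    then show "negligible {t \<in> {a..y} - {L..y}. \<theta> t \<noteq> 0}" by (simp only: negligible_empty)
  qed
  have x: "x \<in> {L<..<R}" by (auto simp: L_def R_def)
  then have "((\<lambda>y. integral {L..y} \<theta>) has_vector_derivative \<theta> x) (at x within {L..R})"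
    by (intro integral_has_vector_derivative test_function_continuous[OF \<theta>]) auto
  then have "((\<lambda>y. integral {L..y} \<theta>) has_vector_derivative \<theta> x) (at x within {L<..<R})"
    by (rule has_vector_derivative_within_subset) auto
  then show ?thesis
    unfolding * has_real_derivative_iff_has_vector_derivative
      has_vector_derivative_within_open[OF x open_greaterThanLessThan] .
qed

text \<open>To the left of the support the antiderivative vanishes trivially; to the right of it,
  its value is the total integral, which is 0.\<close>

lemma test_function_antiderivative:
  fixes \<theta> :: "real \<Rightarrow> real"
  assumes \<theta>: "test_function a b \<theta>" and 0: "integral {a..b} \<theta> = 0"
  shows "test_function a b (\<lambda>x. integral {a..x} \<theta>)"
proof -
  obtain r s where rs: "a < r" "s < b" "\<And>x. x \<notin> {r..s} \<Longrightarrow> \<theta> x = 0" and sm: "smooth_fun \<theta>"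
    using \<theta> unfolding test_function_iff by blast
  have "integral {a..x} \<theta> = 0" if x: "x \<notin> {r..s}" for x
  proof -
    consider "x < r" | "s < x" using x by force
    then show ?thesis
    proof cases
      case 1
      then show ?thesis using rs(3) by (intro integral_unique has_integral_is_0) auto
    next
      case 2
      have "integral {a..x} \<theta> = integral {a..b} \<theta>"
      proof (rule integral_spike_set)
        have supp: "t \<le> b \<and> t \<le> x" if "\<theta> t \<noteq> 0" for t
          using 2 rs(2) rs(3)[of t] that by (cases "t \<in> {r..s}") auto
        then have "{t \<in> {a..x} - {a..b}. \<theta> t \<noteq> 0} = {}" by auto
        then show "negligible {t \<in> {a..x} - {a..b}. \<theta> t \<noteq> 0}" by (simp only: negligible_empty)
        have "{t \<in> {a..b} - {a..x}. \<theta> t \<noteq> 0} = {}" by (auto dest: supp)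
        then show "negligible {t \<in> {a..b} - {a..x}. \<theta> t \<noteq> 0}" by (simp only: negligible_empty)
      qed
      then show ?thesis using 0 by simp
    qed
  qed
  then show ?thesis
    unfolding test_function_iff using rs(1,2)
    by (intro conjI exI[of _ r] exI[of _ s] smooth_fun_antideriv[OF smooth_antiderivative[OF \<theta>] sm]) auto
qed

text \<open>Subtracting the primitive of \<open>g\<close> from \<open>f\<close> leaves a function
  \<open>h\<close> with weak derivative 0. By the lemma of du Bois-Reymond, \<open>h\<close> is
  almost everywhere constant.\<close>

lemma weak_deriv_imp_indefinite_integral:
  fixes f g :: "real \<Rightarrow> 'a::euclidean_space"
  assumes ab: "a < b" and f: "f absolutely_integrable_on {a..b}" and g: "g absolutely_integrable_on {a..b}"
    and weak: "\<And>\<eta>. test_function a b \<eta> \<Longrightarrow>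
      integral {a<..<b} (\<lambda>x. deriv \<eta> x *\<^sub>R f x) = - integral {a<..<b} (\<lambda>x. \<eta> x *\<^sub>R g x)"
  obtains C where "negligible {x\<in>{a<..<b}. f x \<noteq> C + integral {a..x} g}"
proof -
  define h where "h x = f x - integral {a..x} g" for x
  have gc: "continuous_on {a..b} (\<lambda>x. integral {a..x} g)"
    using g by (intro indefinite_integral_continuous_1) (simp add: absolutely_integrable_on_def)
  then have ga: "(\<lambda>x. integral {a..x} g) absolutely_integrable_on {a..b}"
    by (rule absolutely_integrable_continuous_real)
  have ha: "h absolutely_integrable_on {a..b}"
    unfolding h_def by (rule set_integral_diff(1)[OF f ga])
  have int: "(\<lambda>x. \<eta> x *\<^sub>R u x) integrable_on {a..b}"
    if "test_function a b \<eta>" "u absolutely_integrable_on {a..b}" for \<eta> and u :: "real \<Rightarrow> 'a"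
    using absolutely_integrable_continuous_scaleR[OF test_function_continuous[OF that(1)] that(2)]
    by (simp add: absolutely_integrable_on_def)
  have h0: "integral {a..b} (\<lambda>x. deriv \<eta> x *\<^sub>R h x) = 0" if \<eta>: "test_function a b \<eta>" for \<eta>
  proof -
    have sm: "smooth_fun \<eta>" and \<eta>b: "\<eta> b = 0" using \<eta> unfolding test_function_iff by auto
    note \<eta>' = test_function_deriv[OF \<eta>]
    have "integral {a..b} (\<lambda>x. deriv \<eta> x *\<^sub>R integral {a..x} g) + integral {a..b} (\<lambda>x. \<eta> x *\<^sub>R g x) = 0"
      using integral_by_parts_indefinite[OF less_imp_le[OF ab] g, of \<eta> "deriv \<eta>"]
        smooth_fun_has_deriv[OF sm] test_function_continuous[OF \<eta>'] \<eta>b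
      by (simp add: has_field_derivative_at_within)
    moreover have "integral {a..b} (\<lambda>x. deriv \<eta> x *\<^sub>R h x) =
        integral {a..b} (\<lambda>x. deriv \<eta> x *\<^sub>R f x) - integral {a..b} (\<lambda>x. deriv \<eta> x *\<^sub>R integral {a..x} g)"
      unfolding h_def scaleR_diff_right
      by (intro Henstock_Kurzweil_Integration.integral_diff int \<eta>' f ga)
    ultimately show ?thesis
      using weak[OF \<eta>] unfolding integral_open_interval_real[symmetric]
      by (simp only: add_eq_0_iff minus_minus diff_self)
  qed
  \<comment> \<open>The middle third of the interval is an arbitrary choice; it carries a
    nonnegative test function with nonzero integral.\<close>
  define r s where "r = (2 * a + b) / 3" and "s = (a + 2 * b) / 3"
  have rs: "a < r" "r < s" "s < b" using ab by (auto simp: r_def s_def)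
  obtain \<rho> where \<rho>: "test_function a b \<rho>" "\<And>x. 0 \<le> \<rho> x" "\<And>x. x \<in> {r<..<s} \<Longrightarrow> 0 < \<rho> x"
    using bump_sequence[OF rs(1,3)] by metis
  have \<rho>i: "integral {a..b} \<rho> \<noteq> 0"
  proof
    assume "integral {a..b} \<rho> = 0"
    moreover have "\<rho> integrable_on {a..b}"
      by (intro integrable_continuous_real test_function_continuous[OF \<rho>(1)])
    ultimately have "(\<rho> has_integral 0) (cbox a b)" by (auto simp: has_integral_iff)
    from has_integral_0_cbox_imp_0[OF _ _ this, of "(r + s) / 2"] \<rho>(2) \<rho>(3)[of "(r + s) / 2"] rs
    show False using test_function_continuous[OF \<rho>(1)] by auto
  qed
  \<comment> \<open>The mean of \<open>h\<close> with weight \<rho> is the only possible value of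
    the constant.\<close>
  define C where "C = (1 / integral {a..b} \<rho>) *\<^sub>R integral {a..b} (\<lambda>x. \<rho> x *\<^sub>R h x)"
  have "negligible {x\<in>{a<..<b}. h x - C \<noteq> 0}"
  proof (rule fundamental_lemma_calculus_of_variations)
    have Ca: "(\<lambda>x. C) absolutely_integrable_on {a..b}"
      by (intro absolutely_integrable_continuous_real continuous_intros)
    then have hC: "(\<lambda>x. h x - C) absolutely_integrable_on {a..b}"
      by (intro set_integral_diff(1)[OF ha])
    show "(\<lambda>x. h x - C) absolutely_integrable_on {r..s}" if "a < r" "s < b" for r s
      by (rule absolutely_integrable_on_subinterval[OF hC]) (use that in auto)
    fix \<zeta> assume \<zeta>: "test_function a b \<zeta>"
    define c where "c = integral {a..b} \<zeta> / integral {a..b} \<rho>"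
    \<comment> \<open>Subtracting the multiple of \<open>\<rho>\<close> with the same integral makes the test function a derivative.\<close>
    let ?\<theta> = "\<lambda>x. \<zeta> x + (- c) * \<rho> x"
    have \<theta>: "test_function a b ?\<theta>" by (rule test_function_add_scale[OF \<zeta> \<rho>(1)])
    have i: "\<eta> integrable_on {a..b}" if "test_function a b \<eta>" for \<eta>
      by (intro integrable_continuous_real test_function_continuous[OF that])
    have "(?\<theta> has_integral integral {a..b} \<zeta> + (- c) * integral {a..b} \<rho>) {a..b}"
      by (intro has_integral_add has_integral_mult_right integrable_integral i \<zeta> \<rho>)
    then have "integral {a..b} ?\<theta> = 0" using \<rho>i by (simp add: c_def integral_unique)
    note \<Theta> = test_function_antiderivative[OF \<theta> this]
    have "deriv (\<lambda>x. integral {a..x} ?\<theta>) = ?\<theta>"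
      by (intro ext DERIV_imp_deriv smooth_antiderivative[OF \<theta>])
    then have "0 = integral {a..b} (\<lambda>x. ?\<theta> x *\<^sub>R h x)"
      using h0[OF \<Theta>] by simp
    also have "\<dots> = integral {a..b} (\<lambda>x. \<zeta> x *\<^sub>R h x + (- c) *\<^sub>R (\<rho> x *\<^sub>R h x))"
      by (simp add: algebra_simps)
    also have "\<dots> = integral {a..b} (\<lambda>x. \<zeta> x *\<^sub>R h x) + (- c) *\<^sub>R integral {a..b} (\<lambda>x. \<rho> x *\<^sub>R h x)"
      by (intro integral_unique has_integral_add has_integral_cmul integrable_integral int \<zeta> \<rho> ha)
    also have "\<dots> = integral {a..b} (\<lambda>x. \<zeta> x *\<^sub>R h x) - integral {a..b} \<zeta> *\<^sub>R C"
      using \<rho>i by (simp add: C_def c_def)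
    also have "\<dots> = integral {a..b} (\<lambda>x. \<zeta> x *\<^sub>R h x - \<zeta> x *\<^sub>R C)"
      by (intro integral_unique[symmetric] has_integral_diff has_integral_scaleR_left integrable_integral int i \<zeta> ha)
    finally show "integral {a<..<b} (\<lambda>x. \<zeta> x *\<^sub>R (h x - C)) = 0"
      by (simp add: integral_open_interval_real algebra_simps)
  qed
  then show ?thesis by (intro that[of C]) (simp add: h_def algebra_simps)
qed


section \<open>Continuous representatives of Sobolev functions\<close>

lemma AE_lebesgue_on_iff_negligible:
  assumes "S \<in> sets lebesgue"
  shows "(AE y in lebesgue_on S. P y) \<longleftrightarrow> negligible {y\<in>S. \<not> P y}"
proof -
  have "{y\<in>S. \<not> P y} = {y \<in> space lebesgue. \<not> (y \<in> S \<longrightarrow> P y)}" by auto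
  then show ?thesis
    using assms by (simp add: AE_restrict_space_iff completion.AE_iff_null_sets negligible_iff_null_sets)
qed

lemma integrable_lebesgue_on_iff:
  fixes f :: "real \<Rightarrow> 'a::euclidean_space"
  assumes "S \<in> sets lebesgue"
  shows "integrable (lebesgue_on S) f \<longleftrightarrow> f absolutely_integrable_on S"
  using assms by (simp add: set_integrable_def integrable_restrict_space)

lemma locally_integrable_iff:
  "locally_integrable a b f \<longleftrightarrow> (\<forall>r s. a < r \<longrightarrow> s < b \<longrightarrow> f absolutely_integrable_on {r..s})"
  by (simp add: locally_integrable_def integrable_lebesgue_on_iff)

lemma locally_integrable_test_scaleR:
  assumes "locally_integrable a b f" "test_function a b \<eta>"
  shows "(\<lambda>x. \<eta> x *\<^sub>R f x) integrable_on {a<..<b}"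
    and "integral\<^sup>L (lebesgue_on {a<..<b}) (\<lambda>x. \<eta> x *\<^sub>R f x) = integral {a<..<b} (\<lambda>x. \<eta> x *\<^sub>R f x)"
proof -
  have *: "(\<lambda>x. \<eta> x *\<^sub>R f x) absolutely_integrable_on {a<..<b}"
    using assms by (intro test_function_scaleR_integrable) (auto simp: locally_integrable_iff)
  then show "(\<lambda>x. \<eta> x *\<^sub>R f x) integrable_on {a<..<b}"
    by (simp add: absolutely_integrable_on_def)
  show "integral\<^sup>L (lebesgue_on {a<..<b}) (\<lambda>x. \<eta> x *\<^sub>R f x) = integral {a<..<b} (\<lambda>x. \<eta> x *\<^sub>R f x)"
    using * by (intro lebesgue_integral_eq_integral) (auto simp: integrable_lebesgue_on_iff)
qed

lemma test_function_deriv_iter: "test_function a b \<eta> \<Longrightarrow> test_function a b ((deriv ^^ n) \<eta>)"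
  by (induction n) (auto intro: test_function_deriv)

text \<open>Both notions of integral agree here, since a locally integrable function times a test
  function, or times a derivative of one, is absolutely integrable.\<close>

lemma is_weak_deriv_iff:
  "is_weak_deriv a b n f g \<longleftrightarrow> locally_integrable a b f \<and> locally_integrable a b g \<and>
     (\<forall>\<eta>. test_function a b \<eta> \<longrightarrow> integral {a<..<b} (\<lambda>y. (deriv ^^ n) \<eta> y *\<^sub>R f y) =
        (-1) ^ n * integral {a<..<b} (\<lambda>y. \<eta> y *\<^sub>R g y))"
proof (cases "locally_integrable a b f \<and> locally_integrable a b g")
  case True
  then show ?thesis
    by (auto simp: is_weak_deriv_def locally_integrable_test_scaleR(2) test_function_deriv_iter)
qed (auto simp: is_weak_deriv_def)

lemma is_weak_deriv_0: "locally_integrable a b f \<Longrightarrow> is_weak_deriv a b 0 f f"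
  by (simp add: is_weak_deriv_iff)

lemma is_weak_deriv_unique:
  assumes g: "is_weak_deriv a b n f g" and g': "is_weak_deriv a b n f g'"
  shows "negligible {x\<in>{a<..<b}. g x \<noteq> g' x}"
proof -
  have l: "locally_integrable a b g" "locally_integrable a b g'"
    using assms by (auto simp: is_weak_deriv_iff)
  have "negligible {x\<in>{a<..<b}. g x - g' x \<noteq> 0}"
  proof (rule fundamental_lemma_calculus_of_variations)
    show "(\<lambda>x. g x - g' x) absolutely_integrable_on {r..s}" if "a < r" "s < b" for r s
      using l that by (intro set_integral_diff(1)) (auto simp: locally_integrable_iff)
    fix \<eta> assume \<eta>: "test_function a b \<eta>"
    have "(-1) ^ n * integral {a<..<b} (\<lambda>y. \<eta> y *\<^sub>R g y) = (-1) ^ n * integral {a<..<b} (\<lambda>y. \<eta> y *\<^sub>R g' y)"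
      using g g' \<eta> unfolding is_weak_deriv_iff by metis
    then show "integral {a<..<b} (\<lambda>x. \<eta> x *\<^sub>R (g x - g' x)) = 0"
      using locally_integrable_test_scaleR(1)[OF _ \<eta>] l
      by (simp add: scaleR_diff_right Henstock_Kurzweil_Integration.integral_diff)
  qed
  then show ?thesis by simp
qed

text \<open>Once some weak derivative exists, the choice in \<open>weak_deriv\<close> returns one,
  and uniqueness identifies it with \<open>g\<close> up to a null set.\<close>

lemma weak_deriv_ae_eq:
  assumes "is_weak_deriv a b n f g"
  shows "negligible {x\<in>{a<..<b}. weak_deriv a b n f x \<noteq> g x}"
  using assms is_weak_deriv_unique someI[of "is_weak_deriv a b n f", OF assms]
  unfolding weak_deriv_def by blast

lemma locally_integrable_linear:
  assumes "locally_integrable a b f" "locally_integrable a b g"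
  shows "locally_integrable a b (\<lambda>x. u * f x + v * g x)"
  using assms unfolding locally_integrable_def by (auto intro!: integrable_add integrable_mult_right)

lemma is_weak_deriv_linear:
  assumes "is_weak_deriv a b n f f'" "is_weak_deriv a b n g g'"
  shows "is_weak_deriv a b n (\<lambda>x. u * f x + v * g x) (\<lambda>x. u * f' x + v * g' x)"
proof -
  have lin: "integral {a<..<b} (\<lambda>x. \<eta> x *\<^sub>R (u * f x + v * g x)) =
      u * integral {a<..<b} (\<lambda>x. \<eta> x *\<^sub>R f x) + v * integral {a<..<b} (\<lambda>x. \<eta> x *\<^sub>R g x)"
    if "locally_integrable a b f" "locally_integrable a b g" "test_function a b \<eta>" for f g \<eta>
  proof (rule integral_unique)
    have "((\<lambda>x. u * (\<eta> x *\<^sub>R f x) + v * (\<eta> x *\<^sub>R g x)) has_integral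
      u * integral {a<..<b} (\<lambda>x. \<eta> x *\<^sub>R f x) + v * integral {a<..<b} (\<lambda>x. \<eta> x *\<^sub>R g x)) {a<..<b}"
      using that by (intro has_integral_add has_integral_mult_right integrable_integral locally_integrable_test_scaleR(1))
    then show "((\<lambda>x. \<eta> x *\<^sub>R (u * f x + v * g x)) has_integral
      u * integral {a<..<b} (\<lambda>x. \<eta> x *\<^sub>R f x) + v * integral {a<..<b} (\<lambda>x. \<eta> x *\<^sub>R g x)) {a<..<b}"
      by (simp add: scaleR_add_right)
  qed
  show ?thesis
    using assms unfolding is_weak_deriv_iff
    by (auto simp: lin test_function_deriv_iter locally_integrable_linear distrib_left mult.left_commute)
qed

lemma is_weak_deriv_cong_ae:
  assumes w: "is_weak_deriv a b n f g" and N: "negligible {x\<in>{a<..<b}. f' x \<noteq> f x}"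
  shows "is_weak_deriv a b n f' g"
proof -
  have "locally_integrable a b f'"
    unfolding locally_integrable_iff
  proof (intro allI impI)
    fix r s assume rs: "a < r" "s < b"
    then have "f absolutely_integrable_on {r..s}"
      using w by (simp add: is_weak_deriv_iff locally_integrable_iff)
    then show "f' absolutely_integrable_on {r..s}"
      by (rule absolutely_integrable_spike[OF _ N]) (use rs in auto)
  qed
  moreover have "integral {a<..<b} (\<lambda>y. \<eta> y *\<^sub>R f' y) = integral {a<..<b} (\<lambda>y. \<eta> y *\<^sub>R f y)" for \<eta> :: "real \<Rightarrow> real"
    by (rule integral_spike[OF N]) auto
  ultimately show ?thesis
    using w unfolding is_weak_deriv_iff by simp
qed

text \<open>The j-th derivative of a test function may be used in the relation of order
  \<open>i\<close>. This links the weak derivatives in \<open>sobolev_H\<close>, each of which is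
  defined only relative to the original function.\<close>

lemma is_weak_deriv_of_weak_deriv:
  assumes u: "is_weak_deriv a b i f u" and w: "is_weak_deriv a b (i + j) f w"
  shows "is_weak_deriv a b j u w"
  unfolding is_weak_deriv_iff
proof (intro conjI allI impI)
  show "locally_integrable a b u" "locally_integrable a b w" using assms by (auto simp: is_weak_deriv_iff)
  fix \<eta> assume \<eta>: "test_function a b \<eta>"
  have "(-1) ^ i * integral {a<..<b} (\<lambda>y. (deriv ^^ j) \<eta> y *\<^sub>R u y) =
      integral {a<..<b} (\<lambda>y. (deriv ^^ i) ((deriv ^^ j) \<eta>) y *\<^sub>R f y)"
    using u test_function_deriv_iter[OF \<eta>] by (simp add: is_weak_deriv_iff)
  also have "\<dots> = (-1) ^ i * ((-1) ^ j * integral {a<..<b} (\<lambda>y. \<eta> y *\<^sub>R w y))"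
    using w \<eta> by (simp add: is_weak_deriv_iff funpow_add power_add)
  finally show "integral {a<..<b} (\<lambda>y. (deriv ^^ j) \<eta> y *\<^sub>R u y) = (-1) ^ j * integral {a<..<b} (\<lambda>y. \<eta> y *\<^sub>R w y)"
    by simp
qed

section \<open>From Sobolev functions to classical derivatives\<close>

lemma square_integrable_imp_absolutely_integrable:
  assumes "square_integrable a b f"
  shows "f absolutely_integrable_on {a..b}"
proof -
  have "integrable (lebesgue_on {a<..<b}) (\<lambda>y. 1 + (norm (f y))\<^sup>2)"
  proof (rule Bochner_Integration.integrable_add)
    show "integrable (lebesgue_on {a<..<b}) (\<lambda>y. 1 :: real)"
      by (intro finite_measure.integrable_const finite_measure_lebesgue_on) simp
    show "integrable (lebesgue_on {a<..<b}) (\<lambda>y. (norm (f y))\<^sup>2)"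
      using assms by (simp add: square_integrable_def)
  qed
  then have "integrable (lebesgue_on {a<..<b}) f"
  proof (rule Bochner_Integration.integrable_bound)
    show "f \<in> borel_measurable (lebesgue_on {a<..<b})"
      using assms by (simp add: square_integrable_def)
    \<comment> \<open>This bound dominates |f| by 1 + |f|^2, which is integrable on the bounded
      interval.\<close>
    have "t \<le> 1 + t\<^sup>2" for t :: real
      using zero_le_power2[of "t - 1 / 2"] unfolding power2_diff by (simp add: field_simps)
    then show "AE y in lebesgue_on {a<..<b}. norm (f y) \<le> norm (1 + (norm (f y))\<^sup>2)"
      by (auto intro!: AE_I2 simp: abs_of_nonneg)
  qed
  then show ?thesis
    by (simp add: integrable_lebesgue_on_iff absolutely_integrable_on_Icc_iff_Ioo)
qed

text \<open>The set of disagreement inside (a,b) is open and null, hence empty; continuity extends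
  equality to the end points.\<close>

lemma continuous_ae_eq_imp_eq:
  fixes f g :: "real \<Rightarrow> 'a::real_normed_vector"
  assumes ab: "a < b" and f: "continuous_on {a..b} f" and g: "continuous_on {a..b} g"
    and N: "negligible {x\<in>{a<..<b}. f x \<noteq> g x}" and x: "x \<in> {a..b}"
  shows "f x = g x"
proof -
  have h: "continuous_on {a..b} (\<lambda>x. f x - g x)" by (intro continuous_intros f g)
  have "{x\<in>{a<..<b}. f x \<noteq> g x} = {a<..<b} \<inter> (\<lambda>x. f x - g x) -` (- {0})" by auto
  moreover have "open ({a<..<b} \<inter> (\<lambda>x. f x - g x) -` (- {0}))"
    by (intro continuous_open_preimage continuous_on_subset[OF h]) auto
  ultimately have "{x\<in>{a<..<b}. f x \<noteq> g x} = {}" using N open_not_negligible by metis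
  then have "f x - g x = 0"
    using continuous_constant_on_closure[of "{a<..<b}" "\<lambda>x. f x - g x" 0 x] h x ab by auto
  then show ?thesis by simp
qed

text \<open>\<open>G j\<close> is a constant plus the primitive of \<open>g (Suc j)\<close>, hence
  stops at order \<open>n\<close>. If \<open>g (Suc j)\<close> agrees almost everywhere with a
  continuous \<open>q\<close>, then \<open>G j\<close> has the classical derivative \<open>q\<close>
  up to the end points. Below the top order one can take \<open>q = G (Suc j)\<close>; at the top
  order \<open>q\<close> has to come from elsewhere, later from the differential equation.\<close>

lemma sobolev_H_representatives:
  assumes ab: "a < b" and \<phi>: "\<phi> \<in> sobolev_H (Suc n) a b" and cont: "continuous_on {a..b} \<phi>"
  obtains g G where
    "\<And>j. j \<le> Suc n \<Longrightarrow> is_weak_deriv a b j \<phi> (g j)"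
    "\<And>j. j \<le> n \<Longrightarrow> continuous_on {a..b} (G j)"
    "\<And>j. j \<le> n \<Longrightarrow> negligible {x\<in>{a<..<b}. g j x \<noteq> G j x}"
    "\<And>j q x. j \<le> n \<Longrightarrow> continuous_on {a..b} q \<Longrightarrow> negligible {x\<in>{a<..<b}. g (Suc j) x \<noteq> q x} \<Longrightarrow>
       x \<in> {a..b} \<Longrightarrow> (G j has_vector_derivative q x) (at x within {a..b})"
    "\<And>x. x \<in> {a..b} \<Longrightarrow> G 0 x = \<phi> x"
proof -
  have "\<forall>j. \<exists>u. j \<le> Suc n \<longrightarrow> square_integrable a b u \<and> is_weak_deriv a b j \<phi> u"
    using \<phi> by (auto simp: sobolev_H_def)
  then obtain g where g: "\<And>j. j \<le> Suc n \<Longrightarrow> square_integrable a b (g j)"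
      "\<And>j. j \<le> Suc n \<Longrightarrow> is_weak_deriv a b j \<phi> (g j)"
    by metis
  have gi: "g j absolutely_integrable_on {a..b}" if "j \<le> Suc n" for j
    using square_integrable_imp_absolutely_integrable[OF g(1)[OF that]] .
  have "\<forall>j. \<exists>C. j \<le> n \<longrightarrow> negligible {x\<in>{a<..<b}. g j x \<noteq> C + integral {a..x} (g (Suc j))}"
  proof (intro allI)
    fix j
    show "\<exists>C. j \<le> n \<longrightarrow> negligible {x\<in>{a<..<b}. g j x \<noteq> C + integral {a..x} (g (Suc j))}"
    proof (cases "j \<le> n")
      case True
      have "is_weak_deriv a b 1 (g j) (g (Suc j))"
        using is_weak_deriv_of_weak_deriv[of a b j \<phi> "g j" 1] g(2)[of j] g(2)[of "Suc j"] True by simp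
      then have "integral {a<..<b} (\<lambda>x. deriv \<eta> x *\<^sub>R g j x) = - integral {a<..<b} (\<lambda>x. \<eta> x *\<^sub>R g (Suc j) x)"
        if "test_function a b \<eta>" for \<eta> using that by (simp add: is_weak_deriv_iff)
      then show ?thesis
        using weak_deriv_imp_indefinite_integral[OF ab gi gi, of j "Suc j"] True
        by (meson Suc_le_mono le_SucI)
    qed simp
  qed
  then obtain C where C: "\<And>j. j \<le> n \<Longrightarrow> negligible {x\<in>{a<..<b}. g j x \<noteq> C j + integral {a..x} (g (Suc j))}"
    by metis
  define G where "G j x = C j + integral {a..x} (g (Suc j))" for j x
  have Gc: "continuous_on {a..b} (G j)" if "j \<le> n" for j
    unfolding G_def using gi[of "Suc j"] that
    by (intro continuous_intros indefinite_integral_continuous_1) (simp add: absolutely_integrable_on_def)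
  show ?thesis
  proof (rule that[of g G])
    show "negligible {x\<in>{a<..<b}. g j x \<noteq> G j x}" if "j \<le> n" for j
      using C[OF that] by (simp add: G_def)
    show "(G j has_vector_derivative q x) (at x within {a..b})"
      if "j \<le> n" and q: "continuous_on {a..b} q" and N: "negligible {x\<in>{a<..<b}. g (Suc j) x \<noteq> q x}"
        and x: "x \<in> {a..b}" for j q x
    proof (rule has_vector_derivative_transform[OF x])
      show "G j y = C j + integral {a..y} q" if "y \<in> {a..b}" for y
      proof -
        have "negligible ({x\<in>{a<..<b}. g (Suc j) x \<noteq> q x} \<union> {a, b})" using N by simp
        then have "integral {a..y} (g (Suc j)) = integral {a..y} q"
          by (rule integral_spike) (use that in auto)
        then show ?thesis by (simp add: G_def)
      qed
      show "((\<lambda>y. C j + integral {a..y} q) has_vector_derivative q x) (at x within {a..b})"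
        using has_vector_derivative_add[OF has_vector_derivative_const integral_has_vector_derivative[OF q x]]
        by simp
    qed
    show "G 0 x = \<phi> x" if x: "x \<in> {a..b}" for x
    proof (rule continuous_ae_eq_imp_eq[OF ab Gc cont _ x])
      have "locally_integrable a b \<phi>"
        using g(2)[of 0] by (simp add: is_weak_deriv_iff)
      then have "negligible {x\<in>{a<..<b}. \<phi> x \<noteq> g 0 x}"
        by (intro is_weak_deriv_unique[OF is_weak_deriv_0 g(2)]) auto
      moreover have "negligible {x\<in>{a<..<b}. g 0 x \<noteq> G 0 x}" using C[of 0] by (simp add: G_def)
      ultimately have "negligible ({x\<in>{a<..<b}. \<phi> x \<noteq> g 0 x} \<union> {x\<in>{a<..<b}. g 0 x \<noteq> G 0 x})"
        by (rule negligible_Un)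
      then show "negligible {x\<in>{a<..<b}. G 0 x \<noteq> \<phi> x}" by (rule negligible_subset) auto
    qed simp
  qed (use g Gc in auto)
qed


section \<open>The energy identity\<close>

text \<open>If \<open>W * (V - l)\<close> were nonnegative throughout, the continuous function
  \<open>S\<close> would dominate the energy density \<open>Q\<close>, although its integral is 0.
  Then \<open>S\<close> vanishes, whereas \<open>Q\<close> is positive wherever \<open>f0\<close> is
  nonzero. Here \<open>f0\<close> to \<open>f3\<close> and \<open>q\<close> are \<phi> and its
  derivatives, and \<open>W\<close> is the second derivative of \<open>U\<close>. The number
  \<open>l\<close> stays free because it is later taken both as a value of \<open>V\<close> and as a
  bound for \<open>V\<close>.\<close>

lemma rayleigh_energy:
  fixes a b k \<alpha> l :: real and c :: complex and W V :: "real \<Rightarrow> real"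
    and f0 f1 f2 f3 q :: "real \<Rightarrow> complex"
  assumes ab: "a < b" and \<alpha>: "\<alpha> > 0" and k: "k \<noteq> 0" and c: "Im c > 0"
    and W: "continuous_on {a..b} W" and V: "continuous_on {a..b} V"
    and d0: "\<And>y. y \<in> {a..b} \<Longrightarrow> (f0 has_vector_derivative f1 y) (at y within {a..b})"
    and d1: "\<And>y. y \<in> {a..b} \<Longrightarrow> (f1 has_vector_derivative f2 y) (at y within {a..b})"
    and d2: "\<And>y. y \<in> {a..b} \<Longrightarrow> (f2 has_vector_derivative f3 y) (at y within {a..b})"
    and d3: "\<And>y. y \<in> {a..b} \<Longrightarrow> (f3 has_vector_derivative q y) (at y within {a..b})"
    and q: "\<And>y. y \<in> {a..b} \<Longrightarrow> (of_real (V y) - c) *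
        (f2 y - of_real (\<alpha>\<^sup>2) * (q y - of_real (k\<^sup>2) * f2 y)
          - of_real (k\<^sup>2) * (f0 y - of_real (\<alpha>\<^sup>2) * (f2 y - of_real (k\<^sup>2) * f0 y)))
        = of_real (W y) * f0 y"
    and bc: "f0 a = 0" "f0 b = 0" "f2 a = 0" "f2 b = 0"
    and nz: "y0 \<in> {a..b}" "f0 y0 \<noteq> 0"
  shows "\<exists>y\<in>{a..b}. W y * (V y - l) < 0"
proof (rule ccontr)
  assume neg: "\<not> ?thesis"
  then have WV: "W y * (V y - l) \<ge> 0" if "y \<in> {a..b}" for y using that neg by (meson not_less)
  define A where "A = complex_of_real (\<alpha>\<^sup>2)"
  define \<kappa> where "\<kappa> = complex_of_real (k\<^sup>2)"
  \<comment> \<open>The boundary terms of the integrations by parts that turn the equation tested with \<open>cnj f0\<close>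
    into the energy identity.\<close>
  define B where "B y = (f1 y - A * (f3 y - \<kappa> * f1 y)) * cnj (f0 y)
      + A * (f2 y * cnj (f1 y)) + A * \<kappa> * (f1 y * cnj (f0 y))" for y
  \<comment> \<open>The density that remains in the derivative of \<open>B\<close> after the mixed
    terms \<open>f3 * cnj f1\<close> and \<open>f2 * cnj f0\<close> cancel.\<close>
  define Q where "Q y = (1 + 2 * \<alpha>\<^sup>2 * k\<^sup>2) * (norm (f1 y))\<^sup>2 + \<alpha>\<^sup>2 * (norm (f2 y))\<^sup>2
      + k\<^sup>2 * (1 + \<alpha>\<^sup>2 * k\<^sup>2) * (norm (f0 y))\<^sup>2" for y
  define R where "R y = of_real (W y * (norm (f0 y))\<^sup>2) / (of_real (V y) - c) + of_real (Q y)" for y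
  have Vc: "of_real (V y) - c \<noteq> 0" for y using c by (auto simp: complex_eq_iff)
  have "(B has_vector_derivative R y) (at y within {a..b})" if y: "y \<in> {a..b}" for y
  proof -
    have "(B has_vector_derivative
        (f1 y - A * (f3 y - \<kappa> * f1 y)) * cnj (f1 y) + (f2 y - A * (q y - \<kappa> * f2 y)) * cnj (f0 y)
        + A * (f2 y * cnj (f2 y) + f3 y * cnj (f1 y)) + A * \<kappa> * (f1 y * cnj (f1 y) + f2 y * cnj (f0 y)))
        (at y within {a..b})"
      unfolding B_def
      by (intro has_vector_derivative_add has_vector_derivative_mult has_vector_derivative_diff
          has_vector_derivative_mult_right has_vector_derivative_cnj d0 d1 d2 d3 y)
    moreover have "f2 y - A * (q y - \<kappa> * f2 y) =
        of_real (W y) * f0 y / (of_real (V y) - c) + \<kappa> * (f0 y - A * (f2 y - \<kappa> * f0 y))"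
      using q[OF y, folded A_def \<kappa>_def] Vc[of y] by (simp add: field_simps)
    moreover have "(f1 y - A * (f3 y - \<kappa> * f1 y)) * cnj (f1 y)
        + (of_real (W y) * f0 y / (of_real (V y) - c) + \<kappa> * (f0 y - A * (f2 y - \<kappa> * f0 y))) * cnj (f0 y)
        + A * (f2 y * cnj (f2 y) + f3 y * cnj (f1 y)) + A * \<kappa> * (f1 y * cnj (f1 y) + f2 y * cnj (f0 y)) = R y"
    proof -
      have n: "of_real ((norm z)\<^sup>2) = z * cnj z" for z by (rule complex_norm_square)
      show ?thesis
        unfolding R_def Q_def of_real_add of_real_mult n
        by (simp add: A_def \<kappa>_def algebra_simps add_divide_distrib)
    qed
    ultimately show ?thesis by (simp only:)
  qed
  then have "(R has_integral B b - B a) {a..b}"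
    using ab by (intro fundamental_theorem_of_calculus) auto
  \<comment> \<open>Each summand of \<open>B\<close> has a factor \<open>cnj f0\<close> or
    \<open>f2\<close>, and both vanish at the walls.\<close>
  then have R0: "(R has_integral 0) {a..b}" by (simp add: B_def bc)
  \<comment> \<open>The combination of real and imaginary part of \<open>R\<close> that replaces \<open>Re c\<close> by \<open>l\<close>.\<close>
  define S where "S y = W y * (V y - l) * ((norm (f0 y))\<^sup>2 / (norm (of_real (V y) - c))\<^sup>2) + Q y" for y
  have "((\<lambda>y. Re (R y) + (Re c - l) / Im c * Im (R y)) has_integral 0 + (Re c - l) / Im c * 0) {a..b}"
    using has_integral_Re[OF R0] has_integral_Im[OF R0]
    by (intro has_integral_add has_integral_mult_right) auto
  moreover have "Re (R y) + (Re c - l) / Im c * Im (R y) = S y" for y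
  proof -
    let ?n = "(Re c - V y)\<^sup>2 + (Im c)\<^sup>2"
    have n: "?n > 0" using c by (simp add: add_nonneg_pos)
    have e: "(norm (of_real (V y) - c))\<^sup>2 = ?n"
      by (simp add: cmod_power2 power2_commute)
    have re: "Re (R y) = W y * (norm (f0 y))\<^sup>2 * (V y - Re c) / ?n + Q y"
      and im: "Im (R y) = W y * (norm (f0 y))\<^sup>2 * Im c / ?n"
      by (simp_all add: R_def Re_divide Im_divide power2_commute)
    show ?thesis
      unfolding S_def e re im using c n by (simp add: divide_simps) (simp add: algebra_simps)
  qed
  ultimately have S0: "(S has_integral 0) (cbox a b)" by simp
  have cont: "continuous_on {a..b} f0" "continuous_on {a..b} f1" "continuous_on {a..b} f2"
    using continuous_on_vector_derivative[OF d0] continuous_on_vector_derivative[OF d1]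
      continuous_on_vector_derivative[OF d2] by simp_all
  have "continuous_on (cbox a b) S"
    unfolding S_def Q_def using Vc by (auto intro!: continuous_intros W V cont)
  moreover have Qn: "Q y \<ge> k\<^sup>2 * (1 + \<alpha>\<^sup>2 * k\<^sup>2) * (norm (f0 y))\<^sup>2" for y by (simp add: Q_def)
  have SQ: "S y \<ge> Q y" if "y \<in> {a..b}" for y
    unfolding S_def using WV[OF that] by simp
  moreover have Q0: "Q y \<ge> 0" for y by (simp add: Q_def)
  ultimately have "S y0 = 0"
    using ab nz(1) S0 order_trans[OF Q0 SQ] by (intro has_integral_0_cbox_imp_0[of a b S y0]) auto
  moreover have "0 < k\<^sup>2 * (1 + \<alpha>\<^sup>2 * k\<^sup>2) * (norm (f0 y0))\<^sup>2"
    using k nz(2) by (simp add: add_pos_nonneg)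
  ultimately show False using Qn[of y0] SQ[OF nz(1)] by linarith
qed


section \<open>Normal modes\<close>

lemma continuous_on_ivl_deriv: "smooth_on_ivl a b f \<Longrightarrow> continuous_on {a..b} (ivl_deriv a b n f)"
  unfolding smooth_on_ivl_def
  by (auto intro!: differentiable_imp_continuous_on simp: differentiable_on_def)

text \<open>Derivatives within {a..b} depend only on values there, so the formula for
  \<open>u\<close> on the interval can be differentiated repeatedly. It yields the continuity of the
  second derivative of \<open>U\<close>.\<close>

lemma ivl_deriv_diff_scaled:
  assumes ab: "a < b" and f: "smooth_on_ivl a b (f :: real \<Rightarrow> real)"
    and u: "\<And>y. y \<in> {a..b} \<Longrightarrow> u y = f y - r * ivl_deriv a b m f y" and y: "y \<in> {a..b}"
  shows "ivl_deriv a b n u y = ivl_deriv a b n f y - r * ivl_deriv a b (n + m) f y"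
  using y
proof (induction n arbitrary: y)
  case 0
  then show ?case using u by (simp add: ivl_deriv_def)
next
  case (Suc n)
  have "((\<lambda>s. ivl_deriv a b n f s - r * ivl_deriv a b (n + m) f s) has_vector_derivative
      ivl_deriv a b (Suc n) f y - r * ivl_deriv a b (Suc (n + m)) f y) (at y within {a..b})"
    by (intro has_vector_derivative_diff has_vector_derivative_mult_right
        ivl_deriv_has_vector_derivative f Suc.prems)
  then have "(ivl_deriv a b n u has_vector_derivative
      ivl_deriv a b (Suc n) f y - r * ivl_deriv a b (Suc (n + m)) f y) (at y within {a..b})"
    by (rule has_vector_derivative_transform[OF Suc.prems Suc.IH, rotated])
  then show ?case
    using vector_derivative_within_cbox[of a b y] ab Suc.prems by (simp add: ivl_deriv_Suc)
qed

section \<open>Reduction of the linearized problem to a single mode\<close>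

lemma dx_normal_mode: "dx (normal_mode k c f) = normal_mode k c (\<lambda>y. \<i> * of_real k * f y)"
proof (intro ext)
  fix x y t
  \<comment> \<open>The exponential is differentiated as a holomorphic function and then restricted
    to the real line.\<close>
  have "((\<lambda>z. f y * exp (\<i> * of_real k * (z - c * of_real t))) has_field_derivative
      \<i> * of_real k * f y * exp (\<i> * of_real k * (of_real x - c * of_real t))) (at (of_real x))"
    by (auto intro!: derivative_eq_intros)
  from has_vector_derivative_real_field[OF this, of UNIV]
  show "dx (normal_mode k c f) x y t = normal_mode k c (\<lambda>y. \<i> * of_real k * f y) x y t"
    by (simp add: dx_def normal_mode_def vector_derivative_at)
qed

lemma dt_normal_mode: "dt (normal_mode k c f) = normal_mode k c (\<lambda>y. - (\<i> * of_real k * c) * f y)"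
proof (intro ext)
  fix x y t
  have "((\<lambda>z. f y * exp (\<i> * of_real k * (of_real x - c * z))) has_field_derivative
      - (\<i> * of_real k * c) * f y * exp (\<i> * of_real k * (of_real x - c * of_real t))) (at (of_real t))"
    by (auto intro!: derivative_eq_intros)
  from has_vector_derivative_real_field[OF this, of UNIV]
  show "dt (normal_mode k c f) x y t = normal_mode k c (\<lambda>y. - (\<i> * of_real k * c) * f y) x y t"
    by (simp add: dt_def normal_mode_def vector_derivative_at)
qed

lemma normal_mode_origin: "normal_mode k c f 0 y 0 = f y"
  by (simp add: normal_mode_def)

text \<open>At x = t = 0 the exponential equals 1, and one factor ik can be divided out. The
  function \<psi> is replaced by its expression through \<phi>, with which it agrees almost
  everywhere.\<close>

lemma linearized_normal_mode:
  assumes k: "k \<noteq> 0"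
    and eq: "linearized_stream_eq \<alpha> a b V U (normal_mode k c \<psi>) (normal_mode k c \<phi>)"
    and g2: "is_weak_deriv a b 2 \<phi> g2" and g4: "is_weak_deriv a b 2 g2 g4"
  defines "A \<equiv> complex_of_real (\<alpha>\<^sup>2)" and "\<kappa> \<equiv> complex_of_real (k\<^sup>2)"
  shows "negligible {y\<in>{a<..<b}. (of_real (V y) - c) *
      (g2 y - A * (g4 y - \<kappa> * g2 y) - \<kappa> * (\<phi> y - A * (g2 y - \<kappa> * \<phi> y)))
      \<noteq> of_real (ivl_deriv a b 2 U y) * \<phi> y}"
proof -
  define I where "I = \<i> * complex_of_real k"
  have II: "I * I = - \<kappa>" "I \<noteq> 0" using k by (simp_all add: I_def \<kappa>_def power2_eq_square complex_eq_iff)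
  \<comment> \<open>\<open>\<Psi>\<close> and \<open>P\<close> express \<psi> and its second weak
    derivative through \<phi> and the weak derivatives of \<phi>.\<close>
  define \<Psi> where "\<Psi> y = \<phi> y - A * (g2 y - \<kappa> * \<phi> y)" for y
  define P where "P y = g2 y - A * (g4 y - \<kappa> * g2 y)" for y
  define N0 where "N0 = {y\<in>{a<..<b}. \<not> (
      I * (I * (- (I * c) * \<psi> y)) + weak_deriv a b 2 (\<lambda>s. - (I * c) * \<psi> s) y
      + of_real (V y) * (I * (I * (I * \<psi> y)) + weak_deriv a b 2 (\<lambda>s. I * \<psi> s) y)
      - of_real (ivl_deriv a b 2 U y) * (I * \<phi> y) = 0 \<and>
      \<psi> y = \<phi> y - A * (I * (I * \<phi> y) + weak_deriv a b 2 \<phi> y))}"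
  have N0: "negligible N0"
    using eq[unfolded linearized_stream_eq_def, rule_format, of 0 0]
    unfolding AE_lebesgue_on_iff_negligible[of "{a<..<b}", simplified] weak_laplace_def
      dx_normal_mode dt_normal_mode normal_mode_origin N0_def I_def A_def by simp
  define N1 where "N1 = {y\<in>{a<..<b}. weak_deriv a b 2 \<phi> y \<noteq> g2 y}"
  have N1: "negligible N1" unfolding N1_def by (rule weak_deriv_ae_eq[OF g2])
  have \<psi>: "\<psi> y = \<Psi> y" if "y \<in> {a<..<b}" "y \<notin> N0" "y \<notin> N1" for y
  proof -
    have "\<psi> y = \<phi> y - A * (I * I * \<phi> y + g2 y)" using that by (auto simp: N0_def N1_def mult.assoc)
    then show ?thesis by (simp add: II \<Psi>_def)
  qed
  have \<Psi>P: "is_weak_deriv a b 2 \<Psi> P"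
    using is_weak_deriv_linear[OF g2 g4, of "1 + A * \<kappa>" "- A"]
    unfolding \<Psi>_def P_def by (simp add: algebra_simps)
  \<comment> \<open>As \<open>weak_deriv\<close> is a choice, its value at a multiple of \<psi> need
    not be the multiple of its value at \<psi>. Hence each multiple is compared with
    \<open>P\<close> separately, up to a null set.\<close>
  have mP: "negligible {y\<in>{a<..<b}. weak_deriv a b 2 (\<lambda>s. m * \<psi> s) y \<noteq> m * P y}" for m
  proof (rule weak_deriv_ae_eq, rule is_weak_deriv_cong_ae)
    show "is_weak_deriv a b 2 (\<lambda>s. m * \<Psi> s) (\<lambda>s. m * P s)"
      using is_weak_deriv_linear[OF \<Psi>P \<Psi>P, of m 0] by simp
    have "{y\<in>{a<..<b}. m * \<psi> y \<noteq> m * \<Psi> y} \<subseteq> {y\<in>{a<..<b}. \<psi> y \<noteq> \<Psi> y}" by auto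
    also have "\<dots> \<subseteq> N0 \<union> N1" using \<psi> by blast
    finally show "negligible {y\<in>{a<..<b}. m * \<psi> y \<noteq> m * \<Psi> y}"
      by (rule negligible_subset[OF negligible_Un[OF N0 N1]])
  qed
  define N2 where "N2 = {y\<in>{a<..<b}. weak_deriv a b 2 (\<lambda>s. - (I * c) * \<psi> s) y \<noteq> - (I * c) * P y}"
  define N3 where "N3 = {y\<in>{a<..<b}. weak_deriv a b 2 (\<lambda>s. I * \<psi> s) y \<noteq> I * P y}"
  have "(of_real (V y) - c) * (P y - \<kappa> * \<Psi> y) = of_real (ivl_deriv a b 2 U y) * \<phi> y"
    if y: "y \<in> {a<..<b}" and n: "y \<notin> N0" "y \<notin> N1" "y \<notin> N2" "y \<notin> N3" for y
  proof -
    have E1: "I * (I * (- (I * c) * \<Psi> y)) + - (I * c) * P y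
      + of_real (V y) * (I * (I * (I * \<Psi> y)) + I * P y)
      - of_real (ivl_deriv a b 2 U y) * (I * \<phi> y) = 0"
    proof -
      have "weak_deriv a b 2 (\<lambda>s. - (I * c) * \<psi> s) y = - (I * c) * P y"
        "weak_deriv a b 2 (\<lambda>s. I * \<psi> s) y = I * P y"
        using y n(3,4) unfolding N2_def N3_def by blast+
      moreover have "I * (I * (- (I * c) * \<psi> y)) + weak_deriv a b 2 (\<lambda>s. - (I * c) * \<psi> s) y
        + of_real (V y) * (I * (I * (I * \<psi> y)) + weak_deriv a b 2 (\<lambda>s. I * \<psi> s) y)
        - of_real (ivl_deriv a b 2 U y) * (I * \<phi> y) = 0"
        using y n(1) unfolding N0_def by blast
      ultimately show ?thesis unfolding \<psi>[OF y n(1,2)] by (simp only:)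
    qed
    have E2: "I * (I * (- (I * c) * \<Psi> y)) + - (I * c) * P y
      + of_real (V y) * (I * (I * (I * \<Psi> y)) + I * P y)
      - of_real (ivl_deriv a b 2 U y) * (I * \<phi> y)
      = I * ((of_real (V y) - c) * (P y + (I * I) * \<Psi> y) - of_real (ivl_deriv a b 2 U y) * \<phi> y)"
      by (simp add: algebra_simps)
    show ?thesis using E1 unfolding E2 II(1) using II(2) by simp
  qed
  then have "{y\<in>{a<..<b}. (of_real (V y) - c) * (P y - \<kappa> * \<Psi> y)
      \<noteq> of_real (ivl_deriv a b 2 U y) * \<phi> y} \<subseteq> N0 \<union> N1 \<union> (N2 \<union> N3)" by blast
  moreover have "negligible (N0 \<union> N1 \<union> (N2 \<union> N3))"
    using N0 N1 mP[of "- (I * c)"] mP[of I] unfolding N2_def N3_def by (intro negligible_Un)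
  ultimately show ?thesis unfolding P_def \<Psi>_def by (rule negligible_subset[rotated])
qed

text \<open>The first condition reads ik \<open>f0\<close> = 0. In the second, the tangential
  component of the rotated gradient is \<open>f1\<close>, whose normal derivative is
  \<open>f2\<close> up to the sign \<open>e\<close> of the outer normal.\<close>

lemma stream_boundary_cond_normal_mode:
  assumes ab: "a < b" and k: "k \<noteq> 0"
    and bc: "stream_boundary_cond a b (normal_mode k c \<phi>)"
    and f0: "\<And>y. y \<in> {a..b} \<Longrightarrow> \<phi> y = f0 y"
    and d0: "\<And>y. y \<in> {a..b} \<Longrightarrow> (f0 has_vector_derivative f1 y) (at y within {a..b})"
    and d1: "\<And>y. y \<in> {a..b} \<Longrightarrow> (f1 has_vector_derivative f2 y) (at y within {a..b})"
    and w: "w = a \<or> w = b"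
  shows "f0 w = 0" "f2 w = 0"
proof -
  let ?F = "\<lambda>x y t. - perp_grad a b (normal_mode k c \<phi>) x y t"
  define e :: real where "e = (if w = a then -1 else 1)"
  have e: "e \<noteq> 0" by (simp add: e_def)
  have w': "w \<in> {a..b}" and "(w, (0, e)) \<in> walls a b" using w ab by (auto simp: walls_def e_def)
  then have *: "dot2 (grad a b (normal_mode k c \<phi>) 0 w 0) tangent = 0"
      "dot2 (dir_deriv a b (0, e) ?F 0 w 0) tangent = 0"
    using bc[unfolded stream_boundary_cond_def, rule_format, of "(w, (0, e))" 0 0] by auto
  show "f0 w = 0"
    using *(1) k f0[OF w'] by (simp add: dot2_def grad_def tangent_def dx_normal_mode normal_mode_origin)
  have "dy a b (normal_mode k c \<phi>) 0 s 0 = f1 s" if s: "s \<in> {a..b}" for s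
    by (rule dy_eq[OF ab s _ d0[OF s]]) (simp add: normal_mode_origin f0)
  then have F: "?F 0 s 0 = (f1 s, - (\<i> * of_real k * f0 s))" if "s \<in> {a..b}" for s
    using that by (simp add: perp_grad_def dx_normal_mode normal_mode_origin f0)
  have "dy a b ?F 0 w 0 = (f2 w, - (\<i> * of_real k * f1 w))"
    by (rule dy_eq[where F = ?F and x = 0 and t = 0 and f = "\<lambda>s. (f1 s, - (\<i> * of_real k * f0 s))", OF ab w' F])
       (auto intro!: has_vector_derivative_Pair has_vector_derivative_minus has_vector_derivative_mult_right
          d0 d1 w')
  then show "f2 w = 0"
    using *(2) e by (simp add: dot2_def dir_deriv_def tangent_def)
qed

text \<open>Continuity of \<phi> selects the continuous representative of an H^4 class, so that
  boundary values and pointwise nonvanishing have a meaning. The conclusion includes the existence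
  of a zero of the second derivative of \<open>U\<close>.\<close>

theorem proposition3p7:
  fixes \<alpha> A1 A2 p0 k :: real
    and V U :: "real \<Rightarrow> real"
    and u0 v0 :: "real \<Rightarrow> real \<Rightarrow> real \<times> real"
    and p :: "real \<Rightarrow> real \<Rightarrow> real"
    and c :: complex
    and \<phi> \<psi> :: "real \<Rightarrow> complex"
  assumes "\<alpha> > 0" and "A1 < A2"
    and "smooth_on_ivl A1 A2 V"
    and "ivl_deriv A1 A2 1 V A1 = 0" and "ivl_deriv A1 A2 1 V A2 = 0"
    and "\<And>y. y \<in> {A1..A2} \<Longrightarrow> U y = V y - \<alpha>\<^sup>2 * ivl_deriv A1 A2 2 V y"
    and "u0 = (\<lambda>x y. (U y, 0))" and "v0 = (\<lambda>x y. (V y, 0))"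
    and "p = (\<lambda>x y. p0 - (V y)\<^sup>2 / 2 + \<alpha>\<^sup>2 / 2 * (ivl_deriv A1 A2 1 V y)\<^sup>2)"
    and "steady_alpha_euler \<alpha> A1 A2 u0 v0 p"
    and "k \<noteq> 0" and "Im c > 0"
    and "\<phi> \<in> sobolev_H 4 A1 A2" and "continuous_on {A1..A2} \<phi>"
    and "\<exists>y\<in>{A1..A2}. \<phi> y \<noteq> 0"
    and "linearized_stream_eq \<alpha> A1 A2 V U (normal_mode k c \<psi>) (normal_mode k c \<phi>)"
    and "stream_boundary_cond A1 A2 (normal_mode k c \<phi>)"
  shows "(\<exists>ys\<in>{A1..A2}. ivl_deriv A1 A2 2 U ys = 0) \<and>
         (\<forall>ys\<in>{A1..A2}. ivl_deriv A1 A2 2 U ys = 0 \<longrightarrow>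
            (\<exists>y\<in>{A1..A2}. ivl_deriv A1 A2 2 U y * (V y - V ys) < 0))"
proof -
  note ab = \<open>A1 < A2\<close>
  let ?W = "ivl_deriv A1 A2 2 U"
  have "continuous_on {A1..A2} (\<lambda>y. ivl_deriv A1 A2 2 V y - \<alpha>\<^sup>2 * ivl_deriv A1 A2 (2 + 2) V y)"
    by (intro continuous_intros continuous_on_ivl_deriv assms)
  then have W: "continuous_on {A1..A2} ?W"
    using ivl_deriv_diff_scaled[OF ab assms(3) assms(6), where n = 2]
    by (subst continuous_on_cong[OF refl]) auto
  have V: "continuous_on {A1..A2} V"
    using continuous_on_ivl_deriv[OF assms(3), of 0] by (simp add: ivl_deriv_def)
  have H: "\<phi> \<in> sobolev_H (Suc 3) A1 A2" using assms(13) by simp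
  show ?thesis
  proof (rule sobolev_H_representatives[OF ab H assms(14)])
    fix g G
    assume g: "\<And>j. j \<le> Suc 3 \<Longrightarrow> is_weak_deriv A1 A2 j \<phi> (g j)"
      and Gc: "\<And>j. j \<le> 3 \<Longrightarrow> continuous_on {A1..A2} (G j)"
      and gG: "\<And>j. j \<le> 3 \<Longrightarrow> negligible {x\<in>{A1<..<A2}. g j x \<noteq> G j x}"
      and dG: "\<And>j q x. j \<le> 3 \<Longrightarrow> continuous_on {A1..A2} q \<Longrightarrow>
          negligible {x\<in>{A1<..<A2}. g (Suc j) x \<noteq> q x} \<Longrightarrow>
          x \<in> {A1..A2} \<Longrightarrow> (G j has_vector_derivative q x) (at x within {A1..A2})"
      and G0: "\<And>x. x \<in> {A1..A2} \<Longrightarrow> G 0 x = \<phi> x"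
    have dG': "(G j has_vector_derivative G (Suc j) x) (at x within {A1..A2})"
      if "Suc j \<le> 3" "x \<in> {A1..A2}" for j x
      using dG[of j "G (Suc j)" x] Gc[of "Suc j"] gG[of "Suc j"] that by simp
    define A where "A = complex_of_real (\<alpha>\<^sup>2)"
    define \<kappa> where "\<kappa> = complex_of_real (k\<^sup>2)"
    have A: "A \<noteq> 0" using assms(1) by (simp add: A_def)
    have Vc: "of_real (V y) - c \<noteq> 0" for y using assms(12) by (auto simp: complex_eq_iff)
    \<comment> \<open>The mode equation solved for the fourth derivative of \<phi>. Division by V -
      c is possible because c is not real, so \<open>q\<close> is continuous.\<close>
    define q where "q y = (G 2 y - \<kappa> * (G 0 y - A * (G 2 y - \<kappa> * G 0 y))
        - of_real (?W y) * G 0 y / (of_real (V y) - c)) / A + \<kappa> * G 2 y" for y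
    have q_eq: "q y = z \<longleftrightarrow> (of_real (V y) - c) *
        (G 2 y - A * (z - \<kappa> * G 2 y) - \<kappa> * (G 0 y - A * (G 2 y - \<kappa> * G 0 y)))
        = of_real (?W y) * G 0 y" for y z
    proof -
      have "D * A * ((X - w / D) / A + Y) = D * X - w + D * A * Y" if "D \<noteq> 0" for D X w Y
        using that A by (simp add: field_simps)
      from this[OF Vc[of y]]
      have Dq: "(of_real (V y) - c) * A * q y = (of_real (V y) - c) * (G 2 y - \<kappa> * (G 0 y - A * (G 2 y - \<kappa> * G 0 y)))
          - of_real (?W y) * G 0 y + (of_real (V y) - c) * A * (\<kappa> * G 2 y)"
        unfolding q_def .
      have "(of_real (V y) - c) * (G 2 y - A * (z - \<kappa> * G 2 y) - \<kappa> * (G 0 y - A * (G 2 y - \<kappa> * G 0 y)))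
        - of_real (?W y) * G 0 y = (of_real (V y) - c) * A * (q y - z)"
        unfolding right_diff_distrib[of "(of_real (V y) - c) * A"] Dq by (simp only: algebra_simps)
      moreover have "q y = z \<longleftrightarrow> (of_real (V y) - c) * A * (q y - z) = 0"
        using A Vc[of y] by simp
      ultimately show ?thesis by (simp only: eq_iff_diff_eq_0[where b = "of_real (?W y) * G 0 y"])
    qed
    have qc: "continuous_on {A1..A2} q"
      unfolding q_def using A Vc by (intro continuous_intros W V Gc) auto
    have "is_weak_deriv A1 A2 2 (g 2) (g 4)"
      by (rule is_weak_deriv_of_weak_deriv[of _ _ 2 \<phi>]) (use g[of 2] g[of 4] in simp_all)
    note N = linearized_normal_mode[OF assms(11,16) _ this, folded A_def \<kappa>_def]
    have N: "negligible ({y\<in>{A1<..<A2}. (of_real (V y) - c) *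
        (g 2 y - A * (g 4 y - \<kappa> * g 2 y) - \<kappa> * (\<phi> y - A * (g 2 y - \<kappa> * \<phi> y)))
        \<noteq> of_real (?W y) * \<phi> y} \<union> {y\<in>{A1<..<A2}. g 2 y \<noteq> G 2 y})"
      using N gG[of 2] g[of 2] by (intro negligible_Un) auto
    \<comment> \<open>The top weak derivative thus has the continuous representative
      \<open>q\<close>, which makes \<open>G 3\<close> classically differentiable up to the
      walls.\<close>
    have "negligible {y\<in>{A1<..<A2}. g 4 y \<noteq> q y}"
    proof (rule negligible_subset[OF N], intro subsetI UnCI CollectI conjI; elim CollectE conjE)
      fix y assume y: "y \<in> {A1<..<A2}" "g 4 y \<noteq> q y" "y \<notin> {y\<in>{A1<..<A2}. g 2 y \<noteq> G 2 y}"
      then have "g 2 y = G 2 y" by blast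
      then show "(of_real (V y) - c) *
          (g 2 y - A * (g 4 y - \<kappa> * g 2 y) - \<kappa> * (\<phi> y - A * (g 2 y - \<kappa> * \<phi> y)))
          \<noteq> of_real (?W y) * \<phi> y"
        using y(1,2) q_eq[of y "g 4 y"] G0[of y] by auto
    qed
    then have d3: "(G 3 has_vector_derivative q x) (at x within {A1..A2})" if "x \<in> {A1..A2}" for x
      using dG[of 3 q x] qc that by simp
    have s: "Suc 0 = 1" "Suc 1 = 2" "Suc 2 = 3" by simp_all
    have d0: "(G 0 has_vector_derivative G 1 x) (at x within {A1..A2})"
      and d1: "(G 1 has_vector_derivative G 2 x) (at x within {A1..A2})"
      and d2: "(G 2 has_vector_derivative G 3 x) (at x within {A1..A2})" if "x \<in> {A1..A2}" for x
      using dG'[of 0 x, unfolded s] dG'[of 1 x, unfolded s] dG'[of 2 x, unfolded s] that by auto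
    obtain y0 where y0: "y0 \<in> {A1..A2}" "G 0 y0 \<noteq> 0" using assms(15) G0 by auto
    note bc = stream_boundary_cond_normal_mode[OF ab assms(11,17) G0[symmetric] d0 d1]
    have rayleigh: "\<exists>y\<in>{A1..A2}. ?W y * (V y - l) < 0" for l
    proof (rule rayleigh_energy[OF ab assms(1,11,12) W V d0 d1 d2 d3])
      show "y \<in> {A1..A2} \<Longrightarrow> (of_real (V y) - c) *
          (G 2 y - of_real (\<alpha>\<^sup>2) * (q y - of_real (k\<^sup>2) * G 2 y)
            - of_real (k\<^sup>2) * (G 0 y - of_real (\<alpha>\<^sup>2) * (G 2 y - of_real (k\<^sup>2) * G 0 y)))
          = of_real (?W y) * G 0 y" for y
        by (rule iffD1[OF q_eq[unfolded A_def \<kappa>_def] refl])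
    qed (use bc y0 in auto)
    \<comment> \<open>With \<open>l\<close> equal to - M or M the factor V - l has constant sign, so
      the second derivative of \<open>U\<close> takes both signs and, by connectedness, the value
      0.\<close>
    obtain M where M: "\<And>y. y \<in> {A1..A2} \<Longrightarrow> \<bar>V y\<bar> \<le> M"
      using compact_imp_bounded[OF compact_continuous_image[OF V]]
      unfolding bounded_iff by (metis compact_Icc imageI real_norm_def)
    obtain y1 where y1: "y1 \<in> {A1..A2}" "?W y1 * (V y1 - - M) < 0" using rayleigh by blast
    then have W1: "?W y1 < 0" using M[OF y1(1)] by (auto simp: mult_less_0_iff)
    obtain y2 where y2: "y2 \<in> {A1..A2}" "?W y2 * (V y2 - M) < 0" using rayleigh by blast
    then have W2: "?W y2 > 0" using M[OF y2(1)] by (auto simp: mult_less_0_iff)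
    have "connected (?W ` {A1..A2})" by (intro connected_continuous_image W) simp
    then have "0 \<in> ?W ` {A1..A2}"
      by (rule connectedD_interval[of _ "?W y1" "?W y2"]) (use y1(1) y2(1) W1 W2 in auto)
    \<comment> \<open>The remaining claim is the case where \<open>l\<close> is the value of
      \<open>V\<close> at the given zero.\<close>
    then show ?thesis using rayleigh by auto
  qed
qed

end
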